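(* Let $\omega$ be a non-quasianalytic weight function satisfying $\log(1+t)=o(\omega(t))$ as $t\to\infty$. Then the multiplication operator $M\colon\mathcal{O}_{C,\omega}(\mathbb{R}^N)\times\mathcal{O}'_{C,\omega}(\mathbb{R}^N)\to\mathcal{O}'_{C,\omega}(\mathbb{R}^N)$, $(f,T)\mapsto fT$, is separately continuous and hence a hypocontinuous bilinear mapping.
   Context: Weights. A non-quasianalytic weight function is a continuous increasing function $\omega:[0,\infty)\to[0,\infty)$ such that: ($\alpha$) there is $K\ge 1$ with $\omega(2t)\le K(1+\omega(t))$ for all $t\ge 0$; ($\beta$) $\int_1^\infty \frac{\omega(t)}{1+t^2}\,dt<\infty$; ($\gamma$) there are $a\in\mathbb{R}$, $b>0$ with $\omega(t)\ge a+b\log(1+t)$ for all $t\ge 0$; ($\delta$) $\varphi_\omega(t)=\omega(e^t)$ is convex. It is assumed (normalization) that $\omega$ vanishes on $[0,1]$. For $x\in\mathbb{R}^N$, $\omega(x):=\omega(|x|)$. The Young conjugate is $\varphi^*_\omega(s):=\sup_{t\ge 0}\{st-\varphi_\omega(t)\}$, $s\ge 0$ (the value $+\infty$ is allowed, with $\exp(-\infty)=0$). Spaces. For $m,n\in\mathbb{N}$ let $\mathcal{O}^m_{n,\omega}(\mathbb{R}^N)$ be the space of all $f\in C^\infty(\mathbb{R}^N)$ with $r_{m,n}(f):=\sup_{\alpha\in\mathbb{N}_0^N}\sup_{x\in\mathbb{R}^N}|\partial^\alpha f(x)|\exp\left(-n\omega(x)-m\varphi^*_\omega\left(\frac{|\alpha|}{m}\right)\right)<\infty$,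 with norm $r_{m,n}$. Set $\mathcal{O}_{C,\omega}(\mathbb{R}^N):=\bigcup_{n}\bigcap_{m}\mathcal{O}^m_{n,\omega}(\mathbb{R}^N)$ with the topology of the locally convex inductive limit over $n$ of the projective limits $\mathrm{proj}_m\,\mathcal{O}^m_{n,\omega}(\mathbb{R}^N)$. $\mathcal{O}'_{C,\omega}(\mathbb{R}^N)$ is its strong dual. For $f\in\mathcal{O}_{C,\omega}(\mathbb{R}^N)$ and $T\in\mathcal{O}'_{C,\omega}(\mathbb{R}^N)$, $fT$ is defined by $\langle fT,g\rangle:=\langle T,fg\rangle$, $g\in\mathcal{O}_{C,\omega}(\mathbb{R}^N)$ (the space $\mathcal{O}_{C,\omega}(\mathbb{R}^N)$ is closed under pointwise multiplication and $g\mapsto fg$ is continuous on it). Hypocontinuity. A bilinear map $b\colon E\times F\to G$ between topological vector spaces is hypocontinuous if for every bounded $A\subset E$ the set $\{b(x,\cdot):x\in A\}$ is equicontinuous in $\mathcal{L}(F,G)$, and for every bounded $B\subset F$ the set $\{b(\cdot,y):y\in B\}$ is equicontinuous in $\mathcal{L}(E,G)$. *)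

theory Defs
  imports "HOL-Analysis.Analysis" "HOL-Library.Landau_Symbols"
begin

section \<open>Locally convex spaces of complex-valued functions\<close>

text \<open>
  All vector spaces below are spaces of complex-valued functions with the pointwise operations:
  spaces of functions on \<open>\<real>\<^sup>N\<close>, and spaces of functionals, which are functions on a function space
  extended by zero. A topological vector space is given by its topology, whose
  \<^const>\<open>topspace\<close> is the underlying vector space.
\<close>

definition seminorm_on :: "('a \<Rightarrow> complex) set \<Rightarrow> (('a \<Rightarrow> complex) \<Rightarrow> real) \<Rightarrow> bool" where
  "seminorm_on E p \<longleftrightarrow>
     (\<forall>f\<in>E. 0 \<le> p f) \<and>
     (\<forall>f\<in>E. \<forall>g\<in>E. p (\<lambda>x. f x + g x) \<le> p f + p g) \<and>
     (\<forall>f\<in>E. \<forall>c. p (\<lambda>x. c * f x) = cmod c * p f)"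

definition seminorm_topology ::
  "('a \<Rightarrow> complex) set \<Rightarrow> (('a \<Rightarrow> complex) \<Rightarrow> real) set \<Rightarrow> ('a \<Rightarrow> complex) topology" where
  "seminorm_topology E P = topology (\<lambda>U. U \<subseteq> E \<and>
     (\<forall>f\<in>U. \<exists>Q \<epsilon>. finite Q \<and> Q \<subseteq> P \<and> 0 < \<epsilon> \<and>
        {g \<in> E. \<forall>p\<in>Q. p (\<lambda>x. g x - f x) < \<epsilon>} \<subseteq> U))"

lemma openin_seminorm_topology:
  "openin (seminorm_topology E P) U \<longleftrightarrow> U \<subseteq> E \<and>
     (\<forall>f\<in>U. \<exists>Q \<epsilon>. finite Q \<and> Q \<subseteq> P \<and> 0 < \<epsilon> \<and>
        {g \<in> E. \<forall>p\<in>Q. p (\<lambda>x. g x - f x) < \<epsilon>} \<subseteq> U)"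
proof -
  let ?L = "\<lambda>U. U \<subseteq> E \<and> (\<forall>f\<in>U. \<exists>Q \<epsilon>. finite Q \<and> Q \<subseteq> P \<and> 0 < \<epsilon> \<and>
        {g \<in> E. \<forall>p\<in>Q. p (\<lambda>x. g x - f x) < \<epsilon>} \<subseteq> U)"
  have "istopology ?L"
    unfolding istopology_def
  proof (intro conjI allI impI)
    fix S T assume S: "?L S" and T: "?L T"
    show "S \<inter> T \<subseteq> E" using S by blast
    show "\<forall>f\<in>S \<inter> T. \<exists>Q \<epsilon>. finite Q \<and> Q \<subseteq> P \<and> 0 < \<epsilon> \<and>
        {g \<in> E. \<forall>p\<in>Q. p (\<lambda>x. g x - f x) < \<epsilon>} \<subseteq> S \<inter> T"
    proof
      fix f assume f: "f \<in> S \<inter> T"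
      obtain Q d where 1: "finite Q" "Q \<subseteq> P" "0 < d"
        "{g \<in> E. \<forall>p\<in>Q. p (\<lambda>x. g x - f x) < d} \<subseteq> S" using S f by blast
      obtain R e where 2: "finite R" "R \<subseteq> P" "0 < e"
        "{g \<in> E. \<forall>p\<in>R. p (\<lambda>x. g x - f x) < e} \<subseteq> T" using T f by blast
      have "{g \<in> E. \<forall>p\<in>Q \<union> R. p (\<lambda>x. g x - f x) < min d e} \<subseteq> S \<inter> T"
        using 1(4) 2(4) by auto
      then show "\<exists>Q \<epsilon>. finite Q \<and> Q \<subseteq> P \<and> 0 < \<epsilon> \<and>
        {g \<in> E. \<forall>p\<in>Q. p (\<lambda>x. g x - f x) < \<epsilon>} \<subseteq> S \<inter> T"
        using 1 2 by (intro exI[of _ "Q \<union> R"] exI[of _ "min d e"]) auto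
    qed
  next
    fix K assume K: "\<forall>U\<in>K. ?L U"
    show "\<Union>K \<subseteq> E" using K by blast
    show "\<forall>f\<in>\<Union>K. \<exists>Q \<epsilon>. finite Q \<and> Q \<subseteq> P \<and> 0 < \<epsilon> \<and>
        {g \<in> E. \<forall>p\<in>Q. p (\<lambda>x. g x - f x) < \<epsilon>} \<subseteq> \<Union>K"
    proof
      fix f assume "f \<in> \<Union>K"
      then obtain U where U: "U \<in> K" "f \<in> U" by blast
      obtain Q \<epsilon> where Q: "finite Q" "Q \<subseteq> P" "0 < \<epsilon>"
        "{g \<in> E. \<forall>p\<in>Q. p (\<lambda>x. g x - f x) < \<epsilon>} \<subseteq> U"
        using bspec[OF conjunct2[OF bspec[OF K U(1)]] U(2)] by (elim exE conjE)
      have "U \<subseteq> \<Union>K" using U(1) by (rule Union_upper)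
      with Q show "\<exists>Q \<epsilon>. finite Q \<and> Q \<subseteq> P \<and> 0 < \<epsilon> \<and>
        {g \<in> E. \<forall>p\<in>Q. p (\<lambda>x. g x - f x) < \<epsilon>} \<subseteq> \<Union>K"
        by (intro exI[of _ Q] exI[of _ \<epsilon>] conjI) (assumption+, erule (1) subset_trans)
    qed
  qed
  then show ?thesis
    by (simp add: seminorm_topology_def topology_inverse')
qed

lemma topspace_seminorm_topology [simp]: "topspace (seminorm_topology E P) = E"
proof -
  have "openin (seminorm_topology E P) E"
    unfolding openin_seminorm_topology
    by (intro conjI ballI exI[of _ "{}"] exI[of _ 1]) auto
  then show ?thesis
    by (metis openin_seminorm_topology openin_subset openin_topspace subset_antisym)
qed

text \<open>
  The locally convex inductive limit of the spaces \<open>X n\<close>, \<open>n \<in> I\<close>, over the union of the underlying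
  vector spaces. The finest locally convex topology making all inclusions continuous is the one
  generated by all seminorms whose restriction to every \<open>X n\<close> is continuous; this is confirmed by
  \<open>continuous_map_lc_inductive_limit\<close> and \<open>lc_inductive_limit_finest\<close> below.
\<close>

definition lc_inductive_limit ::
  "'i set \<Rightarrow> ('i \<Rightarrow> ('a \<Rightarrow> complex) topology) \<Rightarrow> ('a \<Rightarrow> complex) topology" where
  "lc_inductive_limit I X = seminorm_topology (\<Union>n\<in>I. topspace (X n))
     {p. seminorm_on (\<Union>n\<in>I. topspace (X n)) p \<and>
         (\<forall>n\<in>I. continuous_map (X n) euclideanreal p)}"

definition linear_space :: "('a \<Rightarrow> complex) set \<Rightarrow> bool" where
  "linear_space E \<longleftrightarrow> (\<lambda>x. 0) \<in> E \<and> (\<forall>f\<in>E. \<forall>g\<in>E. (\<lambda>x. f x + g x) \<in> E) \<and>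
     (\<forall>f\<in>E. \<forall>c. (\<lambda>x. c * f x) \<in> E)"

lemma linear_space_diff:
  assumes "linear_space E" "f \<in> E" "g \<in> E"
  shows "(\<lambda>x. f x - g x) \<in> E"
proof -
  have add: "\<forall>f\<in>E. \<forall>g\<in>E. (\<lambda>x. f x + g x) \<in> E"
    and scale: "\<forall>f\<in>E. \<forall>c. (\<lambda>x. c * f x) \<in> E"
    using assms(1) unfolding linear_space_def by blast+
  from bspec[OF bspec[OF add assms(2)] spec[OF bspec[OF scale assms(3)], of "-1"]]
  show ?thesis by simp
qed

lemma seminorm_on_diff_commute:
  assumes "seminorm_on E p" "linear_space E" "f \<in> E" "g \<in> E"
  shows "p (\<lambda>x. f x - g x) = p (\<lambda>x. g x - f x)"
proof -
  have "\<forall>f\<in>E. \<forall>c. p (\<lambda>x. c * f x) = cmod c * p f"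
    using assms(1) unfolding seminorm_on_def by blast
  from spec[OF bspec[OF this linear_space_diff[OF assms(2,4,3)]], of "-1"]
  show ?thesis by simp
qed

lemma seminorm_on_triangle:
  assumes "seminorm_on E p" "linear_space E" "f \<in> E" "g \<in> E"
  shows "p f \<le> p g + p (\<lambda>x. f x - g x)"
proof -
  have "\<forall>f\<in>E. \<forall>g\<in>E. p (\<lambda>x. f x + g x) \<le> p f + p g"
    using assms(1) unfolding seminorm_on_def by blast
  from bspec[OF bspec[OF this assms(4)] linear_space_diff[OF assms(2,3,4)]]
  show ?thesis by simp
qed

lemma continuous_map_seminorm:
  assumes "linear_space E" "seminorm_on E p" "p \<in> P"
  shows "continuous_map (seminorm_topology E P) euclideanreal p"
  unfolding continuous_map_def
proof (intro conjI allI impI)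
  fix V :: "real set" assume "openin euclideanreal V"
  then have V: "open V" by simp
  have "\<exists>Q \<epsilon>. finite Q \<and> Q \<subseteq> P \<and> 0 < \<epsilon> \<and>
      {g \<in> E. \<forall>q\<in>Q. q (\<lambda>x. g x - f x) < \<epsilon>} \<subseteq> {f \<in> E. p f \<in> V}"
    if f: "f \<in> E" "p f \<in> V" for f
  proof -
    obtain \<epsilon> where \<epsilon>: "\<epsilon> > 0" "\<And>y. dist y (p f) < \<epsilon> \<Longrightarrow> y \<in> V"
      using V f(2) unfolding open_dist by blast
    have "p g \<in> V" if g: "g \<in> E" "p (\<lambda>x. g x - f x) < \<epsilon>" for g
    proof -
      have "\<bar>p g - p f\<bar> \<le> p (\<lambda>x. g x - f x)"
        using seminorm_on_triangle[OF assms(2,1) g(1) f(1)]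
          seminorm_on_triangle[OF assms(2,1) f(1) g(1)]
          seminorm_on_diff_commute[OF assms(2,1) f(1) g(1)] by linarith
      with g(2) show ?thesis by (intro \<epsilon>(2)) (simp add: dist_real_def)
    qed
    then show ?thesis
      using \<epsilon>(1) assms(3) by (intro exI[of _ "{p}"] exI[of _ \<epsilon>]) auto
  qed
  then show "openin (seminorm_topology E P) {f \<in> topspace (seminorm_topology E P). p f \<in> V}"
    unfolding openin_seminorm_topology topspace_seminorm_topology by auto
qed simp

lemma continuous_map_lc_inductive_limit:
  assumes "n \<in> I" "X n = seminorm_topology E P" "linear_space E"
  shows "continuous_map (X n) (lc_inductive_limit I X) (\<lambda>f. f)"
  unfolding continuous_map_def
proof (intro conjI allI impI)
  show "(\<lambda>f. f) \<in> topspace (X n) \<rightarrow> topspace (lc_inductive_limit I X)"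
    using assms(1) by (auto simp: lc_inductive_limit_def)
  fix U assume U: "openin (lc_inductive_limit I X) U"
  have "\<exists>Q \<epsilon>. finite Q \<and> Q \<subseteq> P \<and> 0 < \<epsilon> \<and>
      {g \<in> E. \<forall>q\<in>Q. q (\<lambda>x. g x - f x) < \<epsilon>} \<subseteq> {f \<in> E. f \<in> U}"
    if f: "f \<in> E" "f \<in> U" for f
  proof -
    let ?L = "\<Union>n\<in>I. topspace (X n)"
    obtain Q \<epsilon> where Q: "finite Q" "0 < \<epsilon>"
        "{g \<in> ?L. \<forall>p\<in>Q. p (\<lambda>x. g x - f x) < \<epsilon>} \<subseteq> U"
        "Q \<subseteq> {p. seminorm_on ?L p \<and> (\<forall>n\<in>I. continuous_map (X n) euclideanreal p)}"
      using U f(2) unfolding lc_inductive_limit_def openin_seminorm_topology by blast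
    let ?B = "\<lambda>p. {h \<in> E. p h \<in> {..<\<epsilon>}}"
    have E: "topspace (X n) = E" using assms(2) by simp
    have 0: "(\<lambda>x. 0) \<in> E" using assms(3) by (simp add: linear_space_def)
    have 1: "openin (X n) (?B p)" if "p \<in> Q" for p
    proof -
      have "continuous_map (X n) euclideanreal p" using that Q(4) assms(1) by blast
      then show ?thesis
        using openin_continuous_map_preimage[of "X n" euclideanreal p "{..<\<epsilon>}"] E by simp
    qed
    have "openin (X n) (topspace (X n) \<inter> (\<Inter>p\<in>Q. ?B p))"
      using 1 Q(1) by (cases "Q = {}") (auto intro!: openin_Int openin_INT)
    then have 2: "openin (seminorm_topology E P) (E \<inter> (\<Inter>p\<in>Q. ?B p))"
      using assms(2) by simp
    have 3: "p (\<lambda>x. 0) = 0" if "p \<in> Q" for p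
    proof -
      have "seminorm_on ?L p" "(\<lambda>x. 0) \<in> ?L" using that Q(4) 0 E assms(1) by auto
      then have "\<forall>f\<in>?L. \<forall>c. p (\<lambda>x. c * f x) = cmod c * p f" "(\<lambda>x. 0) \<in> ?L"
        unfolding seminorm_on_def by blast+
      from spec[OF bspec[OF this], of 0] show ?thesis by simp
    qed
    have "(\<lambda>x. 0) \<in> ?B p" if "p \<in> Q" for p using 0 3[OF that] Q(2) by simp
    then have 4: "(\<lambda>x. 0) \<in> E \<inter> (\<Inter>p\<in>Q. ?B p)" using 0 by blast
    obtain R \<delta> where R: "finite R" "R \<subseteq> P" "0 < \<delta>"
      "{g \<in> E. \<forall>q\<in>R. q (\<lambda>x. g x - 0) < \<delta>} \<subseteq> E \<inter> (\<Inter>p\<in>Q. ?B p)"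
      using bspec[OF conjunct2[OF 2[unfolded openin_seminorm_topology]] 4] by blast
    have "g \<in> U" if g: "g \<in> E" "\<forall>q\<in>R. q (\<lambda>x. g x - f x) < \<delta>" for g
    proof -
      have "(\<lambda>x. g x - f x) \<in> E" using linear_space_diff assms(3) g(1) f(1) by blast
      then have "(\<lambda>x. g x - f x) \<in> E \<inter> (\<Inter>p\<in>Q. ?B p)" using R(4) g(2) by auto
      then have "\<forall>p\<in>Q. p (\<lambda>x. g x - f x) < \<epsilon>" by auto
      then show ?thesis using Q(3) g(1) E assms(1) by blast
    qed
    then show ?thesis using R(1-3) by blast
  qed
  then show "openin (X n) {f \<in> topspace (X n). f \<in> U}"
    unfolding assms(2) openin_seminorm_topology topspace_seminorm_topology by auto
qed

lemma lc_inductive_limit_finest: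
  assumes "linear_space E" "E = (\<Union>n\<in>I. topspace (X n))" "\<forall>p\<in>P. seminorm_on E p"
    and "\<forall>n\<in>I. continuous_map (X n) (seminorm_topology E P) (\<lambda>f. f)"
    and "openin (seminorm_topology E P) U"
  shows "openin (lc_inductive_limit I X) U"
proof -
  have "continuous_map (X n) euclideanreal p" if "n \<in> I" "p \<in> P" for n p
    using continuous_map_compose[OF assms(4)[rule_format, OF that(1)]
        continuous_map_seminorm[OF assms(1) _ that(2)]] assms(3) that(2)
    by (simp add: comp_def)
  then have "P \<subseteq> {p. seminorm_on E p \<and> (\<forall>n\<in>I. continuous_map (X n) euclideanreal p)}"
    using assms(3) by blast
  then show ?thesis
    using assms(5) unfolding lc_inductive_limit_def assms(2)[symmetric] openin_seminorm_topology
    by (elim conjE) (intro conjI ballI, assumption, drule (1) bspec, elim exE conjE,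
      intro exI conjI, assumption, erule (1) subset_trans, assumption+)
qed

definition linear_map ::
  "('a \<Rightarrow> complex) set \<Rightarrow> ('b \<Rightarrow> complex) set \<Rightarrow> (('a \<Rightarrow> complex) \<Rightarrow> ('b \<Rightarrow> complex)) \<Rightarrow> bool" where
  "linear_map E F h \<longleftrightarrow> h \<in> E \<rightarrow> F \<and>
     (\<forall>f\<in>E. \<forall>g\<in>E. h (\<lambda>x. f x + g x) = (\<lambda>y. h f y + h g y)) \<and>
     (\<forall>f\<in>E. \<forall>c. h (\<lambda>x. c * f x) = (\<lambda>y. c * h f y))"

definition continuous_linear_maps ::
  "('a \<Rightarrow> complex) topology \<Rightarrow> ('b \<Rightarrow> complex) topology \<Rightarrow>
    (('a \<Rightarrow> complex) \<Rightarrow> ('b \<Rightarrow> complex)) set" where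
  "continuous_linear_maps X Y = {h. linear_map (topspace X) (topspace Y) h \<and> continuous_map X Y h}"

definition tvs_bounded :: "('a \<Rightarrow> complex) topology \<Rightarrow> ('a \<Rightarrow> complex) set \<Rightarrow> bool" where
  "tvs_bounded X B \<longleftrightarrow> B \<subseteq> topspace X \<and>
     (\<forall>U. openin X U \<and> (\<lambda>x. 0) \<in> U \<longrightarrow>
        (\<exists>s>0. \<forall>t>s. B \<subseteq> (\<lambda>f x. complex_of_real t * f x) ` U))"

definition equicontinuous ::
  "('a \<Rightarrow> complex) topology \<Rightarrow> ('b \<Rightarrow> complex) topology \<Rightarrow>
    (('a \<Rightarrow> complex) \<Rightarrow> ('b \<Rightarrow> complex)) set \<Rightarrow> bool" where
  "equicontinuous X Y H \<longleftrightarrow> H \<subseteq> continuous_linear_maps X Y \<and>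
     (\<forall>V. openin Y V \<and> (\<lambda>y. 0) \<in> V \<longrightarrow>
        (\<exists>U. openin X U \<and> (\<lambda>x. 0) \<in> U \<and> (\<forall>h\<in>H. h ` U \<subseteq> V)))"

definition bilinear_map ::
  "('a \<Rightarrow> complex) set \<Rightarrow> ('b \<Rightarrow> complex) set \<Rightarrow> ('c \<Rightarrow> complex) set \<Rightarrow>
    (('a \<Rightarrow> complex) \<Rightarrow> ('b \<Rightarrow> complex) \<Rightarrow> ('c \<Rightarrow> complex)) \<Rightarrow> bool" where
  "bilinear_map E F G b \<longleftrightarrow>
     (\<forall>u\<in>E. linear_map F G (\<lambda>v. b u v)) \<and> (\<forall>v\<in>F. linear_map E G (\<lambda>u. b u v))"

definition separately_continuous ::
  "('a \<Rightarrow> complex) topology \<Rightarrow> ('b \<Rightarrow> complex) topology \<Rightarrow> ('c \<Rightarrow> complex) topology \<Rightarrow>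
    (('a \<Rightarrow> complex) \<Rightarrow> ('b \<Rightarrow> complex) \<Rightarrow> ('c \<Rightarrow> complex)) \<Rightarrow> bool" where
  "separately_continuous X Y Z b \<longleftrightarrow>
     (\<forall>u\<in>topspace X. continuous_map Y Z (\<lambda>v. b u v)) \<and>
     (\<forall>v\<in>topspace Y. continuous_map X Z (\<lambda>u. b u v))"

definition hypocontinuous ::
  "('a \<Rightarrow> complex) topology \<Rightarrow> ('b \<Rightarrow> complex) topology \<Rightarrow> ('c \<Rightarrow> complex) topology \<Rightarrow>
    (('a \<Rightarrow> complex) \<Rightarrow> ('b \<Rightarrow> complex) \<Rightarrow> ('c \<Rightarrow> complex)) \<Rightarrow> bool" where
  "hypocontinuous X Y Z b \<longleftrightarrow>
     (\<forall>A. tvs_bounded X A \<longrightarrow> equicontinuous Y Z ((\<lambda>u v. b u v) ` A)) \<and>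
     (\<forall>B. tvs_bounded Y B \<longrightarrow> equicontinuous X Z ((\<lambda>v u. b u v) ` B))"

text \<open>
  Continuous linear functionals, extended by zero outside the space so that the dual is again a
  space of functions with the pointwise operations.
\<close>

definition continuous_dual :: "('a \<Rightarrow> complex) topology \<Rightarrow> (('a \<Rightarrow> complex) \<Rightarrow> complex) set" where
  "continuous_dual X = {T.
     (\<forall>f\<in>topspace X. \<forall>g\<in>topspace X. T (\<lambda>x. f x + g x) = T f + T g) \<and>
     (\<forall>f\<in>topspace X. \<forall>c. T (\<lambda>x. c * f x) = c * T f) \<and>
     continuous_map X euclidean T \<and>
     (\<forall>f. f \<notin> topspace X \<longrightarrow> T f = 0)}"

definition strong_dual :: "('a \<Rightarrow> complex) topology \<Rightarrow> (('a \<Rightarrow> complex) \<Rightarrow> complex) topology" where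
  "strong_dual X = seminorm_topology (continuous_dual X)
     {\<lambda>T. SUP f\<in>B. cmod (T f) |B. tvs_bounded X B \<and> B \<noteq> {}}"


section \<open>Weight functions\<close>

definition nonquasianalytic_weight :: "(real \<Rightarrow> real) \<Rightarrow> bool" where
  "nonquasianalytic_weight \<omega> \<longleftrightarrow>
     continuous_on {0..} \<omega> \<and> mono_on {0..} \<omega> \<and> (\<forall>t\<ge>0. 0 \<le> \<omega> t) \<and>
     (\<exists>K\<ge>1. \<forall>t\<ge>0. \<omega> (2 * t) \<le> K * (1 + \<omega> t)) \<and>
     set_integrable lborel {1..} (\<lambda>t. \<omega> t / (1 + t\<^sup>2)) \<and>
     (\<exists>a b. b > 0 \<and> (\<forall>t\<ge>0. a + b * ln (1 + t) \<le> \<omega> t)) \<and>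
     convex_on UNIV (\<lambda>t. \<omega> (exp t)) \<and>
     (\<forall>t\<in>{0..1}. \<omega> t = 0)"

definition young_conjugate :: "(real \<Rightarrow> real) \<Rightarrow> real \<Rightarrow> ereal" where
  "young_conjugate \<omega> s = (SUP t\<in>{0..}. ereal (s * t - \<omega> (exp t)))"

definition exp_ereal :: "ereal \<Rightarrow> ereal" where
  "exp_ereal z = (case z of ereal r \<Rightarrow> ereal (exp r) | PInfty \<Rightarrow> \<infinity> | MInfty \<Rightarrow> 0)"

lemma exp_ereal_simps [simp]:
  "exp_ereal (ereal r) = ereal (exp r)" "exp_ereal \<infinity> = \<infinity>" "exp_ereal (-\<infinity>) = 0"
  by (simp_all add: exp_ereal_def)


section \<open>Partial derivatives\<close>

definition partial :: "'n::finite \<Rightarrow> (real ^ 'n \<Rightarrow> complex) \<Rightarrow> (real ^ 'n \<Rightarrow> complex)" where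
  "partial i f = (\<lambda>x. vector_derivative (\<lambda>t. f (x + t *\<^sub>R axis i 1)) (at 0))"

definition smooth :: "(real ^ 'n::finite \<Rightarrow> complex) \<Rightarrow> bool" where
  "smooth f \<longleftrightarrow> (\<forall>is. foldr partial is f differentiable_on UNIV)"

text \<open>
  The index type carries no order, so an enumeration of the coordinates is fixed. By symmetry of
  iterated partial derivatives its choice is irrelevant for smooth functions.
\<close>

definition coordinates :: "'n::finite list" where
  "coordinates = (SOME is. distinct is \<and> set is = UNIV)"

definition mderiv :: "('n::finite \<Rightarrow> nat) \<Rightarrow> (real ^ 'n \<Rightarrow> complex) \<Rightarrow> (real ^ 'n \<Rightarrow> complex)" where
  "mderiv \<alpha> f = foldr (\<lambda>i. partial i ^^ \<alpha> i) coordinates f"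

definition mabs :: "('n::finite \<Rightarrow> nat) \<Rightarrow> nat" where
  "mabs \<alpha> = (\<Sum>i\<in>UNIV. \<alpha> i)"


section \<open>The space \<open>\<O>\<^bsub>C,\<omega>\<^esub>\<close>, its dual, and multiplication\<close>

definition r_norm :: "(real \<Rightarrow> real) \<Rightarrow> nat \<Rightarrow> nat \<Rightarrow> (real ^ 'n::finite \<Rightarrow> complex) \<Rightarrow> ereal" where
  "r_norm \<omega> m n f = (SUP \<alpha>. SUP x. ereal (cmod (mderiv \<alpha> f x)) *
     exp_ereal (- ereal (real n * \<omega> (norm x)) -
       ereal (real m) * young_conjugate \<omega> (real (mabs \<alpha>) / real m)))"

definition O_mn :: "(real \<Rightarrow> real) \<Rightarrow> nat \<Rightarrow> nat \<Rightarrow> (real ^ 'n::finite \<Rightarrow> complex) set" where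
  "O_mn \<omega> m n = {f. smooth f \<and> r_norm \<omega> m n f < \<infinity>}"

text \<open>The projective limit over \<open>m\<close> for fixed \<open>n\<close>.\<close>

definition O_step :: "(real \<Rightarrow> real) \<Rightarrow> nat \<Rightarrow> (real ^ 'n::finite \<Rightarrow> complex) topology" where
  "O_step \<omega> n = seminorm_topology (\<Inter>m\<in>{1..}. O_mn \<omega> m n)
     {\<lambda>f. real_of_ereal (r_norm \<omega> m n f) |m. m \<ge> 1}"

definition O_C :: "(real \<Rightarrow> real) \<Rightarrow> (real ^ 'n::finite \<Rightarrow> complex) topology" where
  "O_C \<omega> = lc_inductive_limit {1..} (O_step \<omega>)"

definition O_C_dual :: "(real \<Rightarrow> real) \<Rightarrow> ((real ^ 'n::finite \<Rightarrow> complex) \<Rightarrow> complex) topology" where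
  "O_C_dual \<omega> = strong_dual (O_C \<omega>)"

lemma topspace_O_C: "topspace (O_C \<omega>) = (\<Union>n\<in>{1..}. \<Inter>m\<in>{1..}. O_mn \<omega> m n)"
  by (simp add: O_C_def lc_inductive_limit_def O_step_def)

definition mult_functional ::
  "(real \<Rightarrow> real) \<Rightarrow> (real ^ 'n::finite \<Rightarrow> complex) \<Rightarrow> ((real ^ 'n \<Rightarrow> complex) \<Rightarrow> complex) \<Rightarrow>
    ((real ^ 'n \<Rightarrow> complex) \<Rightarrow> complex)" where
  "mult_functional \<omega> f T = (\<lambda>g. if g \<in> topspace (O_C \<omega>) then T (\<lambda>x. f x * g x) else 0)"

end

theory Submission
  imports Defs
begin

text \<open>
  The space \<open>\<O>\<^bsub>C,\<omega>\<^esub>\<close> is the inductive limit of the Frechet spaces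
  \<open>E n = \<Inter>m. \<O>\<^sup>m\<^bsub>n,\<omega>\<^esub>\<close>. By the uniform boundedness principle on each \<open>E n\<close>, the supremum of a
  pointwise bounded family of continuous seminorms is continuous, i.e. the limit is barrelled.
  The Leibniz rule shows that multiplication maps \<open>E n \<times> E l\<close> continuously into \<open>E (n + l)\<close>: the
  factor \<open>2 ^ |\<alpha>|\<close> is absorbed by passing from \<open>m\<close> to a larger \<open>m'\<close>, by condition \<open>(\<alpha>)\<close> on the
  weight. Barrelledness of \<open>\<O>\<^bsub>C,\<omega>\<^esub>\<close> gives both halves of hypocontinuity.
  For \<open>A\<close>, \<open>B\<close> bounded, \<open>g \<mapsto> sup {p (f g) | f \<in> A}\<close> is
  a continuous seminorm, so \<open>A \<cdot> B\<close> is bounded, and polars of \<open>A \<cdot> B\<close> give equicontinuity in \<open>T\<close>.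
  For \<open>D\<close> bounded in the dual, \<open>f \<mapsto> sup {|T (f g)| | T \<in> D, g \<in> B}\<close> is a continuous seminorm,
  which gives equicontinuity in \<open>f\<close>. Separate continuity is the case of singletons.
\<close>

section \<open>Spaces with a topology given by seminorms\<close>


text \<open>The Leibniz estimate compares norms on one pair of steps \<open>E n\<close>,
  \<open>E l\<close>, whereas boundedness is available only as a bound for every continuous seminorm
  of the limit and says nothing about steps. Barrelledness bridges this gap: it asks only for
  pointwise bounds, and these follow from continuity of multiplication by one fixed function, which
  does lie in some step. Derivatives are indexed by lists of coordinates instead of multi-indices.
  The product rule then has one unweighted term for each way of distributing the list over the two
  factors, which is the origin of the factor \<open>2 ^ |\<alpha>|\<close>; symmetry of mixed
  partial derivatives makes the two indexings agree. The hypothesis on the logarithm enters by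
  making the Young conjugate finite, so that the extended-real norms can be replaced by real ones.
  Completeness of a step is required only for series whose \<open>k\<close>-th term is at most
  \<open>(1/2) ^ k\<close> in the \<open>k\<close>-th norm; for these, termwise differentiation is
  available.\<close>

lemma linear_space_0: "linear_space E \<Longrightarrow> (\<lambda>x. 0) \<in> E"
  and linear_space_add: "linear_space E \<Longrightarrow> f \<in> E \<Longrightarrow> g \<in> E \<Longrightarrow> (\<lambda>x. f x + g x) \<in> E"
  and linear_space_scale: "linear_space E \<Longrightarrow> f \<in> E \<Longrightarrow> (\<lambda>x. c * f x) \<in> E"
  unfolding linear_space_def by auto

lemma seminorm_on_nonneg: "seminorm_on E p \<Longrightarrow> f \<in> E \<Longrightarrow> 0 \<le> p f"
  and seminorm_on_add: "seminorm_on E p \<Longrightarrow> f \<in> E \<Longrightarrow> g \<in> E \<Longrightarrow> p (\<lambda>x. f x + g x) \<le> p f + p g"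
  and seminorm_on_scale: "seminorm_on E p \<Longrightarrow> f \<in> E \<Longrightarrow> p (\<lambda>x. c * f x) = cmod c * p f"
  unfolding seminorm_on_def by auto

lemma seminorm_on_scale_real:
  "seminorm_on E p \<Longrightarrow> f \<in> E \<Longrightarrow> 0 \<le> c \<Longrightarrow> p (\<lambda>x. complex_of_real c * f x) = c * p f"
  by (simp add: seminorm_on_scale)

lemma seminorm_on_0: "seminorm_on E p \<Longrightarrow> linear_space E \<Longrightarrow> p (\<lambda>x. 0) = 0"
  using seminorm_on_scale[OF _ linear_space_0, of E p 0] by simp

lemma seminorm_on_subset: "seminorm_on E p \<Longrightarrow> F \<subseteq> E \<Longrightarrow> seminorm_on F p"
  unfolding seminorm_on_def by blast

lemma seminorm_on_SUP:
  assumes E: "linear_space E" and q: "\<And>i. i \<in> I \<Longrightarrow> seminorm_on E (q i)" and I: "I \<noteq> {}"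
    and bdd: "\<And>f. f \<in> E \<Longrightarrow> bdd_above ((\<lambda>i. q i f) ` I)"
  shows "seminorm_on E (\<lambda>f. SUP i\<in>I. q i f)"
  unfolding seminorm_on_def
proof (intro conjI ballI allI)
  have upper: "q i f \<le> (SUP i\<in>I. q i f)" if "i \<in> I" "f \<in> E" for i f
    using that bdd by (intro cSUP_upper) auto
  fix f assume f: "f \<in> E"
  obtain i where i: "i \<in> I" using I by blast
  show nn: "0 \<le> (SUP i\<in>I. q i f)"
    using upper[OF i f] seminorm_on_nonneg[OF q[OF i] f] by linarith
  show "(SUP i\<in>I. q i (\<lambda>x. f x + g x)) \<le> (SUP i\<in>I. q i f) + (SUP i\<in>I. q i g)" if g: "g \<in> E" for g
  proof (rule cSUP_least[OF I])
    fix i assume i: "i \<in> I"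
    show "q i (\<lambda>x. f x + g x) \<le> (SUP i\<in>I. q i f) + (SUP i\<in>I. q i g)"
      using seminorm_on_add[OF q[OF i] f g] upper[OF i f] upper[OF i g] by linarith
  qed
  show "(SUP i\<in>I. q i (\<lambda>x. c * f x)) = cmod c * (SUP i\<in>I. q i f)" for c
  proof (cases "c = 0")
    case True
    then have "(SUP i\<in>I. q i (\<lambda>x. c * f x)) = (SUP i\<in>I. 0)"
      using seminorm_on_0[OF q E] by (intro SUP_cong) auto
    then show ?thesis using True I by simp
  next
    case False
    show ?thesis
    proof (rule antisym)
      show "(SUP i\<in>I. q i (\<lambda>x. c * f x)) \<le> cmod c * (SUP i\<in>I. q i f)"
        using upper f by (intro cSUP_least[OF I]) (auto simp: seminorm_on_scale[OF q] mult_left_mono)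
      have "(SUP i\<in>I. q i f) \<le> (SUP i\<in>I. q i (\<lambda>x. c * f x)) / cmod c"
      proof (rule cSUP_least[OF I])
        fix i assume i: "i \<in> I"
        show "q i f \<le> (SUP i\<in>I. q i (\<lambda>x. c * f x)) / cmod c"
          using upper[OF i linear_space_scale[OF E f], of c] False
          by (simp add: seminorm_on_scale[OF q[OF i] f] field_simps)
      qed
      then show "cmod c * (SUP i\<in>I. q i f) \<le> (SUP i\<in>I. q i (\<lambda>x. c * f x))"
        using False by (simp add: field_simps)
    qed
  qed
qed

text \<open>Rescale \<open>f\<close> into the ball of radius \<open>d\<close>. Since
  \<open>p f\<close> may vanish, the scaling uses a number slightly larger than \<open>p f\<close>,
  at the cost of an arbitrarily small error \<open>e\<close>.\<close>

lemma seminorm_dominated_homogeneous: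
  assumes "linear_space E" "seminorm_on E p" "seminorm_on E q" and d: "0 < d" "0 \<le> c"
    and *: "\<And>f. f \<in> E \<Longrightarrow> p f \<le> d \<Longrightarrow> q f \<le> c" and f: "f \<in> E"
  shows "q f \<le> (c / d) * p f"
proof (rule field_le_epsilon)
  fix e :: real assume e: "0 < e"
  \<comment> \<open>A positive majorant of \<open>c\<close>, so that division is possible when
    \<open>c = 0\<close>.\<close>
  define k where "k = c + 1"
  have k: "0 < k" "c \<le> k" using d by (auto simp: k_def)
  \<comment> \<open>The surplus over \<open>p f\<close> is chosen so that after multiplication by
    \<open>c / d\<close> it contributes \<open>e * (c / k)\<close>, which is at most
    \<open>e\<close>.\<close>
  define s where "s = p f + e * d / k"
  have s: "s > 0" "p f \<le> s"
    using seminorm_on_nonneg[OF assms(2) f] e d(1) k(1) by (auto simp: s_def add_nonneg_pos)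
  let ?g = "\<lambda>x. complex_of_real (d / s) * f x"
  have g: "?g \<in> E" using assms(1) f by (rule linear_space_scale)
  have "p ?g = (d / s) * p f"
    using s d by (intro seminorm_on_scale_real[OF assms(2) f]) simp
  also have "\<dots> \<le> d" using s d by (simp add: field_simps)
  finally have "q ?g \<le> c" by (rule *[OF g])
  moreover have "q ?g = (d / s) * q f"
    using s d by (intro seminorm_on_scale_real[OF assms(3) f]) simp
  ultimately have "(d / s) * q f \<le> c" by linarith
  then have "q f \<le> (c / d) * s" using s(1) d(1) by (simp add: field_simps)
  also have "\<dots> = (c / d) * p f + e * (c / k)"
    unfolding s_def distrib_left using d(1) by simp
  also have "e * (c / k) \<le> e * 1" using e k by (intro mult_left_mono) auto
  finally show "q f \<le> (c / d) * p f + e" by simp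
qed

lemma seminorm_topology_nhd_0:
  assumes "openin (seminorm_topology E P) V" "(\<lambda>x. 0) \<in> V"
  obtains Q \<epsilon> where "finite Q" "Q \<subseteq> P" "0 < \<epsilon>" "{f \<in> E. \<forall>q\<in>Q. q f < \<epsilon>} \<subseteq> V"
proof -
  obtain Q \<epsilon> where "finite Q" "Q \<subseteq> P" "0 < \<epsilon>" "{g \<in> E. \<forall>q\<in>Q. q (\<lambda>x. g x - 0) < \<epsilon>} \<subseteq> V"
    using bspec[OF conjunct2[OF assms(1)[unfolded openin_seminorm_topology]] assms(2)]
    by (elim exE conjE)
  then show thesis by (intro that[of Q \<epsilon>]) auto
qed

lemma openin_seminorm_ball:
  assumes "linear_space E" "\<And>p. p \<in> P \<Longrightarrow> seminorm_on E p" "finite Q" "Q \<subseteq> P"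
  shows "openin (seminorm_topology E P) {f \<in> E. \<forall>q\<in>Q. q f < \<epsilon>}"
  using assms(3,4)
proof (induction Q)
  case empty
  show ?case using openin_topspace[of "seminorm_topology E P"] by simp
next
  case (insert p Q)
  have "continuous_map (seminorm_topology E P) euclideanreal p"
    using insert assms by (intro continuous_map_seminorm) auto
  then have "openin (seminorm_topology E P) {f \<in> topspace (seminorm_topology E P). p f \<in> {..<\<epsilon>}}"
    by (rule openin_continuous_map_preimage) simp
  then have "openin (seminorm_topology E P) ({f \<in> E. p f < \<epsilon>} \<inter> {f \<in> E. \<forall>q\<in>Q. q f < \<epsilon>})"
    using insert by (intro openin_Int) auto
  also have "{f \<in> E. p f < \<epsilon>} \<inter> {f \<in> E. \<forall>q\<in>Q. q f < \<epsilon>} = {f \<in> E. \<forall>q\<in>insert p Q. q f < \<epsilon>}" by auto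
  finally show ?case .
qed

lemma tvs_bounded_seminorm:
  assumes X: "linear_space (topspace X)" and p: "seminorm_on (topspace X) p"
    and c: "continuous_map X euclideanreal p" and B: "tvs_bounded X B"
  obtains C where "\<And>f. f \<in> B \<Longrightarrow> p f \<le> C"
proof -
  have 0: "(\<lambda>x. 0) \<in> topspace X" using X by (rule linear_space_0)
  have "openin X {f \<in> topspace X. p f \<in> {..<1}}"
    by (rule openin_continuous_map_preimage[OF c]) simp
  moreover have "(\<lambda>x. 0) \<in> {f \<in> topspace X. p f \<in> {..<1}}"
    using seminorm_on_0[OF p X] 0 by simp
  ultimately obtain s where s: "s > 0"
    "\<forall>t>s. B \<subseteq> (\<lambda>f x. complex_of_real t * f x) ` {f \<in> topspace X. p f \<in> {..<1}}"
    using B unfolding tvs_bounded_def by blast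
  have "p f \<le> s + 1" if "f \<in> B" for f
  proof -
    have "f \<in> (\<lambda>f x. complex_of_real (s + 1) * f x) ` {f \<in> topspace X. p f \<in> {..<1}}"
      using s(2)[rule_format, of "s + 1"] that by (simp add: subset_iff)
    then obtain g where g: "f = (\<lambda>x. complex_of_real (s + 1) * g x)" "g \<in> topspace X" "p g < 1"
      by auto
    have "p f = (s + 1) * p g"
      unfolding g(1) using s(1) by (intro seminorm_on_scale_real[OF p g(2)]) simp
    then show ?thesis using g(3) s(1) mult_left_mono[of "p g" 1 "s + 1"] by simp
  qed
  then show thesis by (rule that)
qed

text \<open>A neighbourhood of 0 involves only finitely many seminorms, so separate bounds combine
  into one absorbing scale. From here on bounded sets are handled through seminorm bounds
  alone.\<close>

lemma tvs_bounded_seminorm_topology_iff: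
  assumes E: "linear_space E" and P: "\<And>p. p \<in> P \<Longrightarrow> seminorm_on E p"
  shows "tvs_bounded (seminorm_topology E P) B \<longleftrightarrow> B \<subseteq> E \<and> (\<forall>p\<in>P. \<exists>C. \<forall>f\<in>B. p f \<le> C)"
proof (intro iffI conjI ballI)
  assume B: "tvs_bounded (seminorm_topology E P) B"
  then show "B \<subseteq> E" by (simp add: tvs_bounded_def)
  fix p assume p: "p \<in> P"
  show "\<exists>C. \<forall>f\<in>B. p f \<le> C"
    using tvs_bounded_seminorm[OF _ _ continuous_map_seminorm[OF E P[OF p] p] B] E P[OF p]
    by (metis topspace_seminorm_topology)
next
  assume B: "B \<subseteq> E \<and> (\<forall>p\<in>P. \<exists>C. \<forall>f\<in>B. p f \<le> C)"
  then obtain C where C: "\<And>p f. p \<in> P \<Longrightarrow> f \<in> B \<Longrightarrow> p f \<le> C p" by metis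
  show "tvs_bounded (seminorm_topology E P) B"
    unfolding tvs_bounded_def
  proof (intro conjI allI impI)
    show "B \<subseteq> topspace (seminorm_topology E P)" using B by simp
    fix U assume U: "openin (seminorm_topology E P) U \<and> (\<lambda>x. 0) \<in> U"
    obtain Q \<epsilon> where Q: "finite Q" "Q \<subseteq> P" "0 < \<epsilon>" "{f \<in> E. \<forall>q\<in>Q. q f < \<epsilon>} \<subseteq> U"
      by (rule seminorm_topology_nhd_0[OF conjunct1[OF U] conjunct2[OF U]])
    \<comment> \<open>A common bound for the finitely many seminorms; a sum instead of a maximum
      also covers empty \<open>Q\<close>. The \<open>+ 1\<close> in the threshold below makes it
      positive.\<close>
    define D where "D = (\<Sum>q\<in>Q. \<bar>C q\<bar>)"
    have D: "C q \<le> D" if "q \<in> Q" for q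
      using member_le_sum[of q Q "\<lambda>q. \<bar>C q\<bar>"] that Q(1) by (simp add: D_def)
    have D0: "0 \<le> D" by (simp add: D_def sum_nonneg)
    have "B \<subseteq> (\<lambda>f x. complex_of_real t * f x) ` U" if t: "t > (D + 1) / \<epsilon>" for t
    proof
      fix f assume f: "f \<in> B"
      have t0: "t > 0" using t D0 Q(3) by (smt (verit) divide_pos_pos)
      let ?g = "\<lambda>x. complex_of_real (1 / t) * f x"
      have "q ?g < \<epsilon>" if q: "q \<in> Q" for q
      proof -
        have "q ?g = (1 / t) * q f"
          using q Q(2) f B t0 by (intro seminorm_on_scale_real[OF P]) auto
        also have "\<dots> = q f / t" by simp
        also have "\<dots> \<le> D / t" using C[of q f] D[OF q] q Q(2) f t0 by (intro divide_right_mono) auto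
        also have "\<dots> < \<epsilon>" using t t0 Q(3) by (simp add: field_simps)
        finally show ?thesis .
      qed
      moreover have "?g \<in> E" using E f B by (intro linear_space_scale) auto
      ultimately have "?g \<in> U" using Q(4) by blast
      then show "f \<in> (\<lambda>f x. complex_of_real t * f x) ` U"
        using t0 by (intro image_eqI[of _ _ ?g]) auto
    qed
    moreover have "(D + 1) / \<epsilon> > 0" using D0 Q(3) by simp
    ultimately show "\<exists>s>0. \<forall>t>s. B \<subseteq> (\<lambda>f x. complex_of_real t * f x) ` U" by blast
  qed
qed

lemma linear_map_diff:
  assumes h: "linear_map E F h" and E: "linear_space E" and f: "f \<in> E" and g: "g \<in> E"
  shows "h (\<lambda>x. f x - g x) = (\<lambda>y. h f y - h g y)"
proof -
  have g': "(\<lambda>x. -1 * g x) \<in> E" using E g by (rule linear_space_scale)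
  have "\<And>f g. f \<in> E \<Longrightarrow> g \<in> E \<Longrightarrow> h (\<lambda>x. f x + g x) = (\<lambda>y. h f y + h g y)"
    and s: "\<And>f c. f \<in> E \<Longrightarrow> h (\<lambda>x. c * f x) = (\<lambda>y. c * h f y)"
    using h by (auto simp: linear_map_def)
  from this(1)[OF f g'] s[OF g, of "-1"] show ?thesis by simp
qed

text \<open>The constant and the seminorm \<open>p\<close> do not depend on \<open>h\<close>, so one
  ball serves all of \<open>H\<close>. Linearity carries the estimate from 0 to every other point,
  which gives the continuity of each single \<open>h\<close>.\<close>

lemma equicontinuous_seminorm_topology:
  assumes E: "linear_space E" and P: "\<And>p. p \<in> P \<Longrightarrow> seminorm_on E p"
    and H: "\<And>h. h \<in> H \<Longrightarrow> linear_map E F h"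
    and le: "\<And>q. q \<in> Q \<Longrightarrow> \<exists>p\<in>P. \<exists>C. \<forall>h\<in>H. \<forall>f\<in>E. q (h f) \<le> C * p f"
  shows "equicontinuous (seminorm_topology E P) (seminorm_topology F Q) H"
proof -
  obtain p C where pC: "\<And>q. q \<in> Q \<Longrightarrow> p q \<in> P"
    "\<And>q h f. q \<in> Q \<Longrightarrow> h \<in> H \<Longrightarrow> f \<in> E \<Longrightarrow> q (h f) \<le> C q * p q f"
    using le by metis
  have main: "\<exists>R \<delta>. finite R \<and> R \<subseteq> P \<and> 0 < \<delta> \<and>
      (\<forall>h\<in>H. \<forall>f\<in>E. (\<forall>p\<in>R. p f < \<delta>) \<longrightarrow> (\<forall>q\<in>Q'. q (h f) < \<epsilon>))"
    if Q': "finite Q'" "Q' \<subseteq> Q" "0 < \<epsilon>" for Q' \<epsilon>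
  proof -
    \<comment> \<open>One constant dominating all \<open>C q\<close>, kept positive so that
      \<open>\<epsilon> / D\<close> is a radius even if \<open>Q'\<close> is empty.\<close>
    define D where "D = (\<Sum>q\<in>Q'. \<bar>C q\<bar>) + 1"
    have D: "C q \<le> D" if "q \<in> Q'" for q
      using member_le_sum[of q Q' "\<lambda>q. \<bar>C q\<bar>"] that Q'(1) by (simp add: D_def)
    have D0: "0 < D" by (simp add: D_def sum_nonneg add_nonneg_pos)
    have "q (h f) < \<epsilon>" if h: "h \<in> H" and f: "f \<in> E" and R: "\<forall>p\<in>p ` Q'. p f < \<epsilon> / D" and q: "q \<in> Q'"
      for h f q
    proof -
      have "q \<in> Q" using q Q'(2) by blast
      have "q (h f) \<le> C q * p q f" using pC(2)[OF \<open>q \<in> Q\<close> h f] .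
      also have "\<dots> \<le> D * p q f"
        by (intro mult_right_mono D q seminorm_on_nonneg[OF P[OF pC(1)[OF \<open>q \<in> Q\<close>]] f])
      also have "\<dots> < \<epsilon>" using R q D0 by (simp add: field_simps)
      finally show ?thesis .
    qed
    then show ?thesis
      using Q' pC(1) D0 by (intro exI[of _ "p ` Q'"] exI[of _ "\<epsilon> / D"]) auto
  qed
  have "continuous_map (seminorm_topology E P) (seminorm_topology F Q) h" if h: "h \<in> H" for h
    unfolding continuous_map_def
  proof (intro conjI allI impI)
    show "h \<in> topspace (seminorm_topology E P) \<rightarrow> topspace (seminorm_topology F Q)"
      using H[OF h] by (simp add: linear_map_def)
    fix V assume V: "openin (seminorm_topology F Q) V"
    have "\<exists>R \<delta>. finite R \<and> R \<subseteq> P \<and> 0 < \<delta> \<and>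
        {g \<in> E. \<forall>p\<in>R. p (\<lambda>x. g x - f x) < \<delta>} \<subseteq> {f \<in> E. h f \<in> V}" if f: "f \<in> E" "h f \<in> V" for f
    proof -
      obtain Q' \<epsilon> where Q': "finite Q'" "Q' \<subseteq> Q" "0 < \<epsilon>"
        "{g \<in> F. \<forall>q\<in>Q'. q (\<lambda>x. g x - h f x) < \<epsilon>} \<subseteq> V"
        using bspec[OF conjunct2[OF V[unfolded openin_seminorm_topology]] f(2)]
        by (elim exE conjE)
      obtain R \<delta> where R: "finite R" "R \<subseteq> P" "0 < \<delta>"
        "\<And>h f q. h \<in> H \<Longrightarrow> f \<in> E \<Longrightarrow> (\<forall>p\<in>R. p f < \<delta>) \<Longrightarrow> q \<in> Q' \<Longrightarrow> q (h f) < \<epsilon>"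
        using main[OF Q'(1-3)] by blast
      have "h g \<in> V" if g: "g \<in> E" "\<forall>p\<in>R. p (\<lambda>x. g x - f x) < \<delta>" for g
      proof -
        have "q (h (\<lambda>x. g x - f x)) < \<epsilon>" if "q \<in> Q'" for q
          using R(4)[OF h linear_space_diff[OF E g(1) f(1)] g(2) that] .
        moreover have "h g \<in> F" using H[OF h] g(1) by (auto simp: linear_map_def)
        ultimately show ?thesis
          using Q'(4) by (auto simp: linear_map_diff[OF H[OF h] E g(1) f(1)])
      qed
      then show ?thesis using R(1-3) by blast
    qed
    then show "openin (seminorm_topology E P) {f \<in> topspace (seminorm_topology E P). h f \<in> V}"
      unfolding openin_seminorm_topology topspace_seminorm_topology by auto
  qed
  then have "H \<subseteq> continuous_linear_maps (seminorm_topology E P) (seminorm_topology F Q)"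
    using H by (auto simp: continuous_linear_maps_def)
  moreover have "\<exists>U. openin (seminorm_topology E P) U \<and> (\<lambda>x. 0) \<in> U \<and> (\<forall>h\<in>H. h ` U \<subseteq> V)"
    if V: "openin (seminorm_topology F Q) V" "(\<lambda>y. 0) \<in> V" for V
  proof -
    obtain Q' \<epsilon> where Q': "finite Q'" "Q' \<subseteq> Q" "0 < \<epsilon>"
      "{f \<in> F. \<forall>q\<in>Q'. q f < \<epsilon>} \<subseteq> V"
      by (rule seminorm_topology_nhd_0[OF V])
    obtain R \<delta> where R: "finite R" "R \<subseteq> P" "0 < \<delta>"
      "\<And>h f q. h \<in> H \<Longrightarrow> f \<in> E \<Longrightarrow> (\<forall>p\<in>R. p f < \<delta>) \<Longrightarrow> q \<in> Q' \<Longrightarrow> q (h f) < \<epsilon>"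
      using main[OF Q'(1-3)] by blast
    let ?U = "{f \<in> E. \<forall>p\<in>R. p f < \<delta>}"
    have "h f \<in> V" if "h \<in> H" "f \<in> ?U" for h f
    proof -
      have "h f \<in> F" "\<forall>q\<in>Q'. q (h f) < \<epsilon>"
        using that H[of h] R(4)[of h f] by (auto simp: linear_map_def)
      then show ?thesis using Q'(4) by blast
    qed
    moreover have "p (\<lambda>x. 0) < \<delta>" if "p \<in> R" for p
      using seminorm_on_0[OF P E, of p] that R(2,3) by auto
    then have "(\<lambda>x. 0) \<in> ?U" using linear_space_0[OF E] by blast
    ultimately show ?thesis
      using openin_seminorm_ball[OF E P R(1,2)] by (intro exI[of _ ?U]) auto
  qed
  ultimately show ?thesis by (auto simp: equicontinuous_def)
qed

section \<open>Uniform boundedness\<close>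

text \<open>Because the \<open>r k\<close> increase, finitely many of them are dominated by a single
  one; a neighbourhood of 0 on which \<open>q < 1\<close> then contains a ball of one
  \<open>r m\<close>, and homogeneity gives the estimate.\<close>

lemma continuous_map_graded_iff:
  fixes r :: "nat \<Rightarrow> ('a \<Rightarrow> complex) \<Rightarrow> real"
  assumes E: "linear_space E" and r: "\<And>k. seminorm_on E (r k)"
    and mono: "\<And>k l f. f \<in> E \<Longrightarrow> k \<le> l \<Longrightarrow> r k f \<le> r l f" and q: "seminorm_on E q"
  shows "continuous_map (seminorm_topology E (range r)) euclideanreal q \<longleftrightarrow>
    (\<exists>C k. \<forall>f\<in>E. q f \<le> C * r k f)"
proof
  assume c: "continuous_map (seminorm_topology E (range r)) euclideanreal q"
  have V: "openin (seminorm_topology E (range r)) {f \<in> E. q f \<in> {..<1}}"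
    using openin_continuous_map_preimage[OF c, of "{..<1}"] by simp
  have 0: "(\<lambda>x. 0) \<in> {f \<in> E. q f \<in> {..<1}}"
    using linear_space_0[OF E] seminorm_on_0[OF q E] by simp
  obtain Q \<epsilon> where Q: "finite Q" "Q \<subseteq> range r" "0 < \<epsilon>"
    "{f \<in> E. \<forall>q\<in>Q. q f < \<epsilon>} \<subseteq> {f \<in> E. q f \<in> {..<1}}"
    by (rule seminorm_topology_nhd_0[OF V 0])
  obtain K where K: "finite K" "Q = r ` K" using finite_subset_image[OF Q(1,2)] by blast
  \<comment> \<open>If \<open>K\<close> is empty the value of \<open>m\<close> is irrelevant, since
    it is compared only with elements of \<open>K\<close>.\<close>
  define m where "m = Max K"
  have m: "k \<le> m" if "k \<in> K" for k unfolding m_def by (rule Max_ge[OF K(1) that])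
  \<comment> \<open>Half the radius turns the strict inequalities of the ball into the weak ones of
    \<open>seminorm_dominated_homogeneous\<close>.\<close>
  have *: "q f \<le> 1" if f: "f \<in> E" "r m f \<le> \<epsilon> / 2" for f
  proof -
    have "p f < \<epsilon>" if p: "p \<in> Q" for p
    proof -
      obtain k where "k \<in> K" "p = r k" using p K(2) by blast
      then have "p f \<le> r m f" using mono[OF f(1) m] by simp
      then show ?thesis using f(2) Q(3) by simp
    qed
    then have "f \<in> {f \<in> E. q f \<in> {..<1}}" using f(1) Q(4) by blast
    then show ?thesis by simp
  qed
  have "q f \<le> (1 / (\<epsilon> / 2)) * r m f" if "f \<in> E" for f
    using Q(3) by (intro seminorm_dominated_homogeneous[OF E r q _ _ * that]) auto
  then show "\<exists>C k. \<forall>f\<in>E. q f \<le> C * r k f" by blast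
next
  assume "\<exists>C k. \<forall>f\<in>E. q f \<le> C * r k f"
  then obtain C k where Ck: "\<And>f. f \<in> E \<Longrightarrow> q f \<le> C * r k f" by blast
  show "continuous_map (seminorm_topology E (range r)) euclideanreal q"
    unfolding continuous_map_def
  proof (intro conjI allI impI)
    fix V :: "real set" assume "openin euclideanreal V"
    then have V: "open V" by simp
    have "\<exists>Q \<epsilon>. finite Q \<and> Q \<subseteq> range r \<and> 0 < \<epsilon> \<and>
        {g \<in> E. \<forall>p\<in>Q. p (\<lambda>x. g x - f x) < \<epsilon>} \<subseteq> {f \<in> E. q f \<in> V}"
      if f: "f \<in> E" "q f \<in> V" for f
    proof -
      obtain e where e: "e > 0" "\<And>y. dist y (q f) < e \<Longrightarrow> y \<in> V"
        using V f(2) unfolding open_dist by blast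
      have "q g \<in> V" if g: "g \<in> E" "r k (\<lambda>x. g x - f x) < e / (\<bar>C\<bar> + 1)" for g
      proof -
        have d: "(\<lambda>x. g x - f x) \<in> E" using linear_space_diff[OF E g(1) f(1)] .
        have "q (\<lambda>x. g x - f x) \<le> C * r k (\<lambda>x. g x - f x)" by (rule Ck[OF d])
        also have "\<dots> \<le> (\<bar>C\<bar> + 1) * r k (\<lambda>x. g x - f x)"
          by (intro mult_right_mono seminorm_on_nonneg[OF r d]) auto
        also have "\<dots> < e" using g(2) by (simp add: field_simps)
        finally have "q (\<lambda>x. g x - f x) < e" .
        then show ?thesis
          using seminorm_on_triangle[OF q E g(1) f(1)] seminorm_on_triangle[OF q E f(1) g(1)]
            seminorm_on_diff_commute[OF q E f(1) g(1)]
          by (intro e(2)) (simp add: dist_real_def)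
      qed
      then show ?thesis
        using e(1) by (intro exI[of _ "{r k}"] exI[of _ "e / (\<bar>C\<bar> + 1)"]) auto
    qed
    then show "openin (seminorm_topology E (range r))
        {f \<in> topspace (seminorm_topology E (range r)). q f \<in> V}"
      unfolding openin_seminorm_topology topspace_seminorm_topology by auto
  qed simp
qed

text \<open>The gliding hump argument: \<open>x (Suc n)\<close> moves \<open>x n\<close> so little that the seminorms \<open>q j\<close>, \<open>j \<le> n\<close>,
  hardly change, but far enough to make \<open>q (Suc n)\<close> large. The limit of \<open>x\<close> violates pointwise
  boundedness.\<close>

theorem uniform_boundedness_graded:
  fixes E :: "('a \<Rightarrow> complex) set"
  assumes E: "linear_space E" and r: "\<And>k. seminorm_on E (r k)"
    and mono: "\<And>k l f. f \<in> E \<Longrightarrow> k \<le> l \<Longrightarrow> r k f \<le> r l f"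
    and complete: "\<And>h. (\<And>k. h k \<in> E) \<Longrightarrow> (\<And>k. r k (h k) \<le> (1/2) ^ k) \<Longrightarrow>
      \<exists>f\<in>E. \<forall>m. (\<lambda>n. r m (\<lambda>x. f x - (\<Sum>k<n. h k x))) \<longlonglongrightarrow> 0"
    and Q: "\<And>q. q \<in> Q \<Longrightarrow> seminorm_on E q" "\<And>q. q \<in> Q \<Longrightarrow> \<exists>C k. \<forall>f\<in>E. q f \<le> C * r k f"
    and bdd: "\<And>f. f \<in> E \<Longrightarrow> \<exists>B. \<forall>q\<in>Q. q f \<le> B"
  shows "\<exists>C k. \<forall>q\<in>Q. \<forall>f\<in>E. q f \<le> C * r k f"
proof (rule ccontr)
  assume neg: "\<not> ?thesis"
  \<comment> \<open>Otherwise all of \<open>Q\<close> would be bounded by \<open>c\<close> on a ball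
    of \<open>r k\<close>, and by homogeneity this would be the uniform estimate that is being
    denied.\<close>
  have large: "\<exists>q\<in>Q. \<exists>f\<in>E. r k f \<le> d \<and> q f > c" if d: "d > 0" for k d and c :: real
  proof (rule ccontr)
    assume "\<not> ?thesis"
    then have "q f \<le> (\<bar>c\<bar> / d) * r k f" if "q \<in> Q" "f \<in> E" for q f
      using that d Q(1) by (intro seminorm_dominated_homogeneous[OF E r]) force+
    with neg show False by blast
  qed
  \<comment> \<open>A state of the construction is the current point, an index, and the seminorm
    made large at this stage. The number \<open>L\<close> serves both as the index of the dominating
    norm and as the constant in front of it.\<close>
  define P where "P = (\<lambda>n (x, L, q). x \<in> E \<and> q \<in> Q \<and> n \<le> L \<and> (1::nat) \<le> L \<and>
    (\<forall>f\<in>E. q f \<le> real L * r L f) \<and> real n \<le> q x)"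
  \<comment> \<open>Dividing by \<open>L\<close> cancels the constant in
    \<open>q f \<le> real L * r L f\<close>, so the \<open>n\<close>-th move changes
    \<open>q\<close> by at most \<open>(1/2) ^ n\<close>. As \<open>L\<close> grows along the
    sequence, this also holds for all earlier seminorms.\<close>
  define R where "R = (\<lambda>n (x, L, q :: ('a \<Rightarrow> complex) \<Rightarrow> real)
    (x', L', q' :: ('a \<Rightarrow> complex) \<Rightarrow> real).
    (L::nat) \<le> L' \<and> r L (\<lambda>t. x' t - x t) \<le> (1/2) ^ n / real L)"
  have dominated: "\<exists>L. N \<le> L \<and> (\<forall>f\<in>E. q f \<le> real L * r L f)" if q: "q \<in> Q" for q and N :: nat
  proof -
    obtain C k where Ck: "\<forall>f\<in>E. q f \<le> C * r k f" using Q(2)[OF q] by blast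
    define L where "L = N + k + nat \<lceil>\<bar>C\<bar>\<rceil>"
    have L: "C \<le> real L" unfolding L_def by linarith
    have "q f \<le> real L * r L f" if f: "f \<in> E" for f
    proof -
      have "q f \<le> C * r k f" using Ck f by blast
      also have "\<dots> \<le> real L * r L f"
        using L mono[OF f, of k L] seminorm_on_nonneg[OF r f]
        by (intro mult_mono) (auto simp: L_def)
      finally show ?thesis .
    qed
    then show ?thesis by (intro exI[of _ L]) (auto simp: L_def)
  qed
  have start: "\<exists>s. P 0 s"
  proof -
    obtain q where q: "q \<in> Q" using large[of 1] by force
    obtain L where "1 \<le> L" "\<forall>f\<in>E. q f \<le> real L * r L f" using dominated[OF q, of 1] by blast
    then have "P 0 (\<lambda>x. 0, L, q)"
      using q linear_space_0[OF E] seminorm_on_nonneg[OF Q(1)[OF q]] by (auto simp: P_def)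
    then show ?thesis ..
  qed
  have step: "\<exists>s'. P (Suc n) s' \<and> R n s s'" if P: "P n s" for n s
  proof -
    obtain x L q where s: "s = (x, L, q)" by (cases s)
    have x: "x \<in> E" and L: "1 \<le> L" using P by (auto simp: P_def s)
    obtain B where B: "\<And>q. q \<in> Q \<Longrightarrow> q x \<le> B" using bdd[OF x] by blast
    \<comment> \<open>\<open>B\<close> bounds every member of \<open>Q\<close> at \<open>x\<close>,
      so whichever \<open>q'\<close> is found, the excess \<open>B\<close> survives the loss of
      \<open>q' x\<close> in the triangle inequality for \<open>x + f\<close>.\<close>
    obtain q' f where q': "q' \<in> Q" and f: "f \<in> E" "r L f \<le> (1/2) ^ n / real L" "q' f > real (Suc n) + B"
      using large[of "(1/2) ^ n / real L"] L by fastforce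
    obtain L' where L': "L + Suc n \<le> L'" "\<forall>f\<in>E. q' f \<le> real L' * r L' f"
      using dominated[OF q', of "L + Suc n"] by blast
    let ?x = "\<lambda>t. x t + f t"
    have x': "?x \<in> E" using linear_space_add[OF E x f(1)] .
    have "q' f \<le> q' x + q' ?x"
      using seminorm_on_triangle[OF Q(1)[OF q'] E f(1) x']
        seminorm_on_diff_commute[OF Q(1)[OF q'] E x' f(1)] by simp
    then have "real (Suc n) \<le> q' ?x" using f(3) B[OF q'] by linarith
    then have "P (Suc n) (?x, L', q')" using x' q' L' by (auto simp: P_def)
    moreover have "R n s (?x, L', q')" using f(2) L'(1) by (simp add: R_def s)
    ultimately show ?thesis by blast
  qed
  obtain S where S: "\<And>n. P n (S n)" "\<And>n. R n (S n) (S (Suc n))"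
    using dependent_nat_choice[of P R] start step by blast
  define x where "x n = fst (S n)" for n
  define L where "L n = fst (snd (S n))" for n
  define q where "q n = snd (snd (S n))" for n
  have Seq: "S n = (x n, L n, q n)" for n by (simp add: x_def L_def q_def)
  have x: "x n \<in> E" and q: "q n \<in> Q" and L: "n \<le> L n" "1 \<le> L n"
    and qL: "\<And>f. f \<in> E \<Longrightarrow> q n f \<le> real (L n) * r (L n) f" and qx: "real n \<le> q n (x n)" for n
    using S(1)[of n] by (auto simp: P_def Seq)
  have L_Suc: "L n \<le> L (Suc n)" and rx: "r (L n) (\<lambda>t. x (Suc n) t - x n t) \<le> (1/2) ^ n / real (L n)" for n
    using S(2)[of n] by (auto simp: R_def Seq)
  have L_mono: "L m \<le> L n" if "m \<le> n" for m n using L_Suc that by (rule lift_Suc_mono_le)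
  define h where "h n = (\<lambda>t. x (Suc n) t - x n t)" for n
  have h: "h n \<in> E" for n unfolding h_def by (rule linear_space_diff[OF E x x])
  have sum_h: "(\<Sum>k<n. h k t) = x n t - x 0 t" for n t
    unfolding h_def by (rule sum_lessThan_telescope)
  have "r n (h n) \<le> (1/2) ^ n" for n
  proof -
    have "r n (h n) \<le> r (L n) (h n)" by (rule mono[OF h L(1)])
    also have "\<dots> \<le> (1/2) ^ n / real (L n)" using rx by (simp add: h_def)
    also have "\<dots> \<le> (1/2) ^ n / 1" using L(2)[of n] by (intro divide_left_mono) auto
    finally show ?thesis by simp
  qed
  from complete[OF h this] obtain f where f: "f \<in> E"
    "\<And>m. (\<lambda>n. r m (\<lambda>t. f t - (x n t - x 0 t))) \<longlonglongrightarrow> 0"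
    by (auto simp: sum_h)
  \<comment> \<open>The increments \<open>h\<close> sum to the limit of \<open>x n - x 0\<close>,
    hence the starting point is added back.\<close>
  let ?z = "\<lambda>t. x 0 t + f t"
  have z: "?z \<in> E" by (rule linear_space_add[OF E x f(1)])
  \<comment> \<open>All later moves together cost at most \<open>2\<close>, the sum of the geometric
    series. Carrying the unspent remainder \<open>2 * (1/2) ^ d\<close> makes the induction
    close.\<close>
  have stay: "q n (x n) - 2 \<le> q n (x (n + d)) - 2 * (1/2) ^ d" for n d
  proof (induction d)
    case (Suc d)
    have "q n (h (n + d)) \<le> real (L n) * r (L n) (h (n + d))" by (rule qL[OF h])
    also have "\<dots> \<le> real (L (n + d)) * r (L (n + d)) (h (n + d))"
      using L_mono[of n "n + d"] mono[OF h, of "L n" "L (n + d)"] seminorm_on_nonneg[OF r h]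
      by (intro mult_mono) auto
    also have "\<dots> \<le> (1/2) ^ (n + d)"
      using rx[of "n + d"] L(2)[of "n + d"] by (simp add: h_def field_simps)
    also have "\<dots> \<le> (1/2) ^ d" by (rule power_decreasing) auto
    finally have "q n (h (n + d)) \<le> (1/2) ^ d" .
    moreover have "q n (x (n + d)) \<le> q n (x (Suc (n + d))) + q n (h (n + d))"
      using seminorm_on_triangle[OF Q(1)[OF q] E x x, of n "n + d" "Suc (n + d)"]
        seminorm_on_diff_commute[OF Q(1)[OF q] E x x, of n "n + d" "Suc (n + d)"]
      by (simp add: h_def)
    ultimately show ?case using Suc by simp
  qed simp
  \<comment> \<open>The bound on \<open>q n\<close> passes to the limit because \<open>q n\<close>
    is dominated by one norm \<open>r (L n)\<close>, in which \<open>x m\<close> converges to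
    \<open>?z\<close>.\<close>
  have "real n - 2 \<le> q n ?z" for n
  proof (rule LIMSEQ_le_const2)
    show "(\<lambda>m. real n - 2 - real (L n) * r (L n) (\<lambda>t. f t - (x m t - x 0 t))) \<longlonglongrightarrow> real n - 2"
      using tendsto_diff[OF tendsto_const tendsto_mult_left[OF f(2)]] by simp
    have "real n - 2 - real (L n) * r (L n) (\<lambda>t. f t - (x m t - x 0 t)) \<le> q n ?z" if "n \<le> m" for m
    proof -
      have pow: "0 \<le> 2 * (1 / 2 :: real) ^ (m - n)" by simp
      have stay': "q n (x n) - 2 \<le> q n (x m) - 2 * (1/2) ^ (m - n)"
        using stay[of n "m - n"] that by simp
      have d: "(\<lambda>t. f t - (x m t - x 0 t)) = (\<lambda>t. ?z t - x m t)" by (simp add: algebra_simps)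
      have "q n (x m) \<le> q n ?z + q n (\<lambda>t. ?z t - x m t)"
        using seminorm_on_triangle[OF Q(1)[OF q] E x z, of n m]
          seminorm_on_diff_commute[OF Q(1)[OF q] E x z, of n m] by simp
      also have "q n (\<lambda>t. ?z t - x m t) \<le> real (L n) * r (L n) (\<lambda>t. ?z t - x m t)"
        by (rule qL[OF linear_space_diff[OF E z x]])
      finally show ?thesis
        using stay' qx[of n] pow unfolding d by linarith
    qed
    then show "\<exists>N. \<forall>m\<ge>N. real n - 2 - real (L n) * r (L n) (\<lambda>t. f t - (x m t - x 0 t)) \<le> q n ?z"
      by blast
  qed
  moreover obtain B where B: "\<And>q. q \<in> Q \<Longrightarrow> q ?z \<le> B" using bdd[OF z] by blast
  moreover obtain n :: nat where "B + 2 < real n" using reals_Archimedean2 by blast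
  ultimately show False using B[OF q[of n]] by (smt (verit))
qed

section \<open>Algebras that are countable inductive limits of Frechet spaces\<close>

text \<open>In \<open>complete\<close> the \<open>k\<close>-th term is measured in the
  \<open>k\<close>-th norm; as the norms increase, such a series converges absolutely in each of
  them, and these are the series the gliding hump produces. In \<open>mult_closed\<close> the step
  indices add because the growth factors \<open>exp (n \<omega>)\<close> and
  \<open>exp (l \<omega>)\<close> multiply.\<close>

locale lf_algebra =
  fixes E :: "nat \<Rightarrow> ('a \<Rightarrow> complex) set" and r :: "nat \<Rightarrow> nat \<Rightarrow> ('a \<Rightarrow> complex) \<Rightarrow> real"
  assumes E: "1 \<le> n \<Longrightarrow> linear_space (E n)"
    and E_mono: "1 \<le> n \<Longrightarrow> n \<le> n' \<Longrightarrow> E n \<subseteq> E n'"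
    and r: "1 \<le> n \<Longrightarrow> seminorm_on (E n) (r n k)"
    and r_mono: "1 \<le> n \<Longrightarrow> f \<in> E n \<Longrightarrow> k \<le> l \<Longrightarrow> r n k f \<le> r n l f"
    and complete: "1 \<le> n \<Longrightarrow> (\<And>k. h k \<in> E n) \<Longrightarrow> (\<And>k. r n k (h k) \<le> (1/2) ^ k) \<Longrightarrow>
      \<exists>f\<in>E n. \<forall>m. (\<lambda>N. r n m (\<lambda>x. f x - (\<Sum>k<N. h k x))) \<longlonglongrightarrow> 0"
    and mult_closed: "1 \<le> n \<Longrightarrow> 1 \<le> l \<Longrightarrow> f \<in> E n \<Longrightarrow> g \<in> E l \<Longrightarrow> (\<lambda>x. f x * g x) \<in> E (n + l)"
    and mult_bound: "1 \<le> n \<Longrightarrow> 1 \<le> l \<Longrightarrow> \<exists>m' C. \<forall>f\<in>E n. \<forall>g\<in>E l.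
      r (n + l) m (\<lambda>x. f x * g x) \<le> C * r n m' f * r l m' g"
begin

section \<open>The inductive limit, its continuous seminorms and barrelledness\<close>

definition limit_space where "limit_space = (\<Union>n\<in>{1..}. E n)"

definition limit_top where
  "limit_top = lc_inductive_limit {1..} (\<lambda>n. seminorm_topology (E n) (range (r n)))"

text \<open>The continuous seminorms of the inductive limit, with continuity on each step already
  replaced by an estimate against one norm; \<open>limit_top_eq\<close> justifies this.\<close>

definition limit_seminorms where
  "limit_seminorms = {p. seminorm_on limit_space p \<and> (\<forall>n\<ge>1. \<exists>C k. \<forall>f\<in>E n. p f \<le> C * r n k f)}"

lemma limit_spaceI: "1 \<le> n \<Longrightarrow> f \<in> E n \<Longrightarrow> f \<in> limit_space"
  by (auto simp: limit_space_def)

lemma limit_spaceE: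
  assumes "f \<in> limit_space"
  obtains n where "1 \<le> n" "f \<in> E n"
  using assms by (auto simp: limit_space_def)

lemma E_subset_limit_space: "1 \<le> n \<Longrightarrow> E n \<subseteq> limit_space"
  by (auto simp: limit_space_def)

lemma limit_seminorms_seminorm: "p \<in> limit_seminorms \<Longrightarrow> seminorm_on limit_space p"
  by (simp add: limit_seminorms_def)

lemma linear_space_limit_space: "linear_space limit_space"
  unfolding linear_space_def
proof (intro conjI ballI allI)
  show "(\<lambda>x. 0) \<in> limit_space" using linear_space_0[OF E[of 1]] by (intro limit_spaceI[of 1]) simp_all
  fix f assume "f \<in> limit_space"
  then obtain n where n: "1 \<le> n" "f \<in> E n" by (rule limit_spaceE)
  show "(\<lambda>x. c * f x) \<in> limit_space" for c
    using n by (intro limit_spaceI[of n] linear_space_scale E)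
  fix g assume "g \<in> limit_space"
  then obtain l where l: "1 \<le> l" "g \<in> E l" by (rule limit_spaceE)
  have "f \<in> E (max n l)" "g \<in> E (max n l)"
    using n l E_mono[of n "max n l"] E_mono[of l "max n l"] by auto
  then show "(\<lambda>x. f x + g x) \<in> limit_space"
    using n by (intro limit_spaceI[of "max n l"] linear_space_add E) auto
qed

lemma limit_top_eq: "limit_top = seminorm_topology limit_space limit_seminorms"
proof -
  have "continuous_map (seminorm_topology (E n) (range (r n))) euclideanreal p \<longleftrightarrow>
      (\<exists>C k. \<forall>f\<in>E n. p f \<le> C * r n k f)" if "seminorm_on limit_space p" "1 \<le> n" for p n
    by (rule continuous_map_graded_iff[OF E r r_mono seminorm_on_subset[OF _ E_subset_limit_space]])
      (assumption | rule that)+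
  then have "{p. seminorm_on limit_space p \<and> (\<forall>n\<in>{1..}. continuous_map (seminorm_topology (E n) (range (r n)))
      euclideanreal p)} = limit_seminorms"
    by (auto simp: limit_seminorms_def)
  then show ?thesis
    by (simp add: limit_top_def lc_inductive_limit_def limit_space_def)
qed

lemma topspace_limit_top: "topspace limit_top = limit_space"
  by (simp add: limit_top_eq)

lemma tvs_bounded_limit_top: "tvs_bounded limit_top B \<longleftrightarrow> B \<subseteq> limit_space \<and> (\<forall>p\<in>limit_seminorms. \<exists>C. \<forall>f\<in>B. p f \<le> C)"
  unfolding limit_top_eq by (rule tvs_bounded_seminorm_topology_iff[OF linear_space_limit_space limit_seminorms_seminorm])

text \<open>This says that \<open>limit_top\<close> is barrelled.\<close>

lemma SUP_in_limit_seminorms: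
  assumes q: "\<And>i. i \<in> I \<Longrightarrow> q i \<in> limit_seminorms" and I: "I \<noteq> {}"
    and bdd: "\<And>f. f \<in> limit_space \<Longrightarrow> \<exists>B. \<forall>i\<in>I. q i f \<le> B"
  shows "(\<lambda>f. SUP i\<in>I. q i f) \<in> limit_seminorms"
  unfolding limit_seminorms_def
proof (intro CollectI conjI allI impI)
  have "bdd_above ((\<lambda>i. q i f) ` I)" if "f \<in> limit_space" for f
    using bdd[OF that] by (auto intro: bdd_aboveI2)
  then show "seminorm_on limit_space (\<lambda>f. SUP i\<in>I. q i f)"
    by (intro seminorm_on_SUP linear_space_limit_space limit_seminorms_seminorm q I)
  fix n :: nat assume n: "1 \<le> n"
  \<comment> \<open>Steps are treated one at a time: \<open>C\<close> and \<open>k\<close> may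
    depend on \<open>n\<close>, as \<open>limit_seminorms\<close> permits.\<close>
  have "\<exists>C k. \<forall>p\<in>q ` I. \<forall>f\<in>E n. p f \<le> C * r n k f"
  proof (rule uniform_boundedness_graded)
    show "\<exists>f\<in>E n. \<forall>m. (\<lambda>N. r n m (\<lambda>x. f x - (\<Sum>k<N. h k x))) \<longlonglongrightarrow> 0"
      if "\<And>k. h k \<in> E n" "\<And>k. r n k (h k) \<le> (1/2) ^ k" for h
      using that by (rule complete[OF n])
    show "seminorm_on (E n) p" if "p \<in> q ` I" for p
      using that q limit_seminorms_seminorm seminorm_on_subset[OF _ E_subset_limit_space[OF n]] by blast
    show "\<exists>C k. \<forall>f\<in>E n. p f \<le> C * r n k f" if "p \<in> q ` I" for p
      using that q n by (auto simp: limit_seminorms_def)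
    show "\<exists>B. \<forall>p\<in>q ` I. p f \<le> B" if "f \<in> E n" for f
      using bdd[OF limit_spaceI[OF n that]] by blast
  qed (use n E r r_mono in auto)
  then obtain C k where "\<And>i f. i \<in> I \<Longrightarrow> f \<in> E n \<Longrightarrow> q i f \<le> C * r n k f" by blast
  then have "\<forall>f\<in>E n. (SUP i\<in>I. q i f) \<le> C * r n k f"
    by (intro ballI cSUP_least[OF I])
  then show "\<exists>C k. \<forall>f\<in>E n. (SUP i\<in>I. q i f) \<le> C * r n k f" by blast
qed

lemma tvs_bounded_limit_top_le: "tvs_bounded limit_top B \<Longrightarrow> p \<in> limit_seminorms \<Longrightarrow> \<exists>C. \<forall>f\<in>B. p f \<le> C"
  by (simp add: tvs_bounded_limit_top)

section \<open>Multiplication and products of bounded sets\<close>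

lemma mult_limit_space: "f \<in> limit_space \<Longrightarrow> g \<in> limit_space \<Longrightarrow> (\<lambda>x. f x * g x) \<in> limit_space"
  by (elim limit_spaceE) (rule limit_spaceI[rotated], rule mult_closed, auto)

text \<open>A fixed \<open>f\<close> lies in some \<open>E n\<close>, so multiplication by it sends
  every \<open>E l\<close> into \<open>E (n + l)\<close> with \<open>r n m f\<close> as part of the
  constant. This is continuity of multiplication in one variable, expressed by pulling back
  seminorms.\<close>

lemma mult_in_limit_seminorms:
  assumes f: "f \<in> limit_space" and p: "p \<in> limit_seminorms"
  shows "(\<lambda>g. p (\<lambda>x. f x * g x)) \<in> limit_seminorms"
  unfolding limit_seminorms_def
proof (intro CollectI conjI allI impI)
  show "seminorm_on limit_space (\<lambda>g. p (\<lambda>x. f x * g x))"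
    unfolding seminorm_on_def
  proof (intro conjI ballI allI)
    fix g assume g: "g \<in> limit_space"
    show "0 \<le> p (\<lambda>x. f x * g x)" by (rule seminorm_on_nonneg[OF limit_seminorms_seminorm[OF p] mult_limit_space[OF f g]])
    show "p (\<lambda>x. f x * (c * g x)) = cmod c * p (\<lambda>x. f x * g x)" for c
      using seminorm_on_scale[OF limit_seminorms_seminorm[OF p] mult_limit_space[OF f g], of c] by (simp add: mult_ac)
    show "p (\<lambda>x. f x * (g x + h x)) \<le> p (\<lambda>x. f x * g x) + p (\<lambda>x. f x * h x)" if h: "h \<in> limit_space" for h
      using seminorm_on_add[OF limit_seminorms_seminorm[OF p] mult_limit_space[OF f g] mult_limit_space[OF f h]]
      by (simp add: distrib_left)
  qed
  obtain n where n: "1 \<le> n" "f \<in> E n" using f by (rule limit_spaceE)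
  fix l :: nat assume l: "1 \<le> l"
  have "\<exists>C k. \<forall>f\<in>E (n + l). p f \<le> C * r (n + l) k f" using p l by (simp add: limit_seminorms_def)
  then obtain C k where Ck: "\<And>f. f \<in> E (n + l) \<Longrightarrow> p f \<le> C * r (n + l) k f" by blast
  obtain m D where D: "\<And>f g. f \<in> E n \<Longrightarrow> g \<in> E l \<Longrightarrow>
      r (n + l) k (\<lambda>x. f x * g x) \<le> D * r n m f * r l m g"
    using mult_bound[OF n(1) l, of k] by blast
  have "p (\<lambda>x. f x * g x) \<le> (\<bar>C\<bar> * (D * r n m f)) * r l m g" if g: "g \<in> E l" for g
  proof -
    have fg: "(\<lambda>x. f x * g x) \<in> E (n + l)" using mult_closed[OF n(1) l n(2) g] .
    have "p (\<lambda>x. f x * g x) \<le> C * r (n + l) k (\<lambda>x. f x * g x)" by (rule Ck[OF fg])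
    also have "\<dots> \<le> \<bar>C\<bar> * r (n + l) k (\<lambda>x. f x * g x)"
      using n(1) by (intro mult_right_mono seminorm_on_nonneg[OF r fg]) auto
    also have "\<dots> \<le> \<bar>C\<bar> * (D * r n m f * r l m g)" by (intro mult_left_mono D n g) auto
    finally show ?thesis by (simp add: mult_ac)
  qed
  then show "\<exists>C k. \<forall>g\<in>E l. p (\<lambda>x. f x * g x) \<le> C * r l k g" by blast
qed

lemma tvs_bounded_mult:
  assumes A: "tvs_bounded limit_top A" and B: "tvs_bounded limit_top B"
  shows "tvs_bounded limit_top {\<lambda>x. f x * g x |f g. f \<in> A \<and> g \<in> B}"
proof (cases "A = {}")
  case True
  then show ?thesis by (auto simp: tvs_bounded_limit_top)
next
  case False
  have AU: "A \<subseteq> limit_space" and BU: "B \<subseteq> limit_space" using A B by (auto simp: tvs_bounded_limit_top)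
  have "\<exists>C. \<forall>h\<in>{\<lambda>x. f x * g x |f g. f \<in> A \<and> g \<in> B}. p h \<le> C" if p: "p \<in> limit_seminorms" for p
  proof -
    let ?q = "\<lambda>f g. p (\<lambda>x. f x * g x)"
    \<comment> \<open>The pointwise bound that barrelledness asks for comes from exchanging the
      roles of the factors: with \<open>g\<close> fixed, \<open>f\<close> runs through a bounded set
      under a continuous seminorm.\<close>
    have bdd: "\<exists>C. \<forall>f\<in>A. ?q f g \<le> C" if g: "g \<in> limit_space" for g
    proof -
      from tvs_bounded_limit_top_le[OF A mult_in_limit_seminorms[OF g p]] show ?thesis by (simp only: mult.commute)
    qed
    have "(\<lambda>g. SUP f\<in>A. ?q f g) \<in> limit_seminorms"
      using AU by (intro SUP_in_limit_seminorms mult_in_limit_seminorms p False bdd) auto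
    from tvs_bounded_limit_top_le[OF B this] obtain C where C: "\<And>g. g \<in> B \<Longrightarrow> (SUP f\<in>A. ?q f g) \<le> C"
      by blast
    have "?q f g \<le> C" if "f \<in> A" "g \<in> B" for f g
    proof -
      have "bdd_above ((\<lambda>f. ?q f g) ` A)"
        using bdd[of g] that BU by (auto simp: bdd_above_def)
      then have "?q f g \<le> (SUP f\<in>A. ?q f g)" using that by (intro cSUP_upper)
      then show ?thesis using C[OF that(2)] by simp
    qed
    then show ?thesis by blast
  qed
  moreover have "{\<lambda>x. f x * g x |f g. f \<in> A \<and> g \<in> B} \<subseteq> limit_space"
    using AU BU by (auto intro: mult_limit_space)
  ultimately show ?thesis by (simp only: tvs_bounded_limit_top) blast
qed

section \<open>Continuous functionals and the strong dual\<close>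

lemma in_limit_seminorms_mono:
  assumes "p \<in> limit_seminorms" "seminorm_on limit_space q" "\<And>f. f \<in> limit_space \<Longrightarrow> q f \<le> p f"
  shows "q \<in> limit_seminorms"
  unfolding limit_seminorms_def
proof (intro CollectI conjI allI impI assms(2))
  fix n :: nat assume n: "1 \<le> n"
  then obtain C k where "\<And>f. f \<in> E n \<Longrightarrow> p f \<le> C * r n k f"
    using assms(1) unfolding limit_seminorms_def by blast
  then have "q f \<le> C * r n k f" if "f \<in> E n" for f
    using assms(3)[OF limit_spaceI[OF n that]] that order_trans by blast
  then show "\<exists>C k. \<forall>f\<in>E n. q f \<le> C * r n k f" by blast
qed

text \<open>A linear functional is continuous exactly if its modulus is a continuous seminorm: one
  direction restricts \<open>T\<close> to the steps, the other uses the ball of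
  \<open>cmod (T f)\<close> itself as neighbourhood. Functionals thereby become seminorms, to which
  the supremum lemma applies.\<close>

lemma dual_iff:
  "T \<in> continuous_dual limit_top \<longleftrightarrow>
    (\<forall>f\<in>limit_space. \<forall>g\<in>limit_space. T (\<lambda>x. f x + g x) = T f + T g) \<and> (\<forall>f\<in>limit_space. \<forall>c. T (\<lambda>x. c * f x) = c * T f) \<and>
    (\<lambda>f. cmod (T f)) \<in> limit_seminorms \<and> (\<forall>f. f \<notin> limit_space \<longrightarrow> T f = 0)"
proof -
  have "continuous_map limit_top euclidean T \<longleftrightarrow> (\<lambda>f. cmod (T f)) \<in> limit_seminorms"
    if add: "\<forall>f\<in>limit_space. \<forall>g\<in>limit_space. T (\<lambda>x. f x + g x) = T f + T g"
      and scale: "\<forall>f\<in>limit_space. \<forall>c. T (\<lambda>x. c * f x) = c * T f"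
  proof
    assume T: "continuous_map limit_top euclidean T"
    have semi: "seminorm_on limit_space (\<lambda>f. cmod (T f))"
      using add scale by (auto simp: seminorm_on_def norm_triangle_ineq norm_mult)
    have "\<exists>C k. \<forall>f\<in>E n. cmod (T f) \<le> C * r n k f" if n: "1 \<le> n" for n
    proof -
      have "continuous_map (seminorm_topology (E n) (range (r n))) limit_top (\<lambda>f. f)"
        unfolding limit_top_def using n
        by (intro continuous_map_lc_inductive_limit[where E = "E n" and P = "range (r n)"] E) auto
      from continuous_map_compose[OF this continuous_map_norm[OF T]]
      have "continuous_map (seminorm_topology (E n) (range (r n))) euclideanreal (\<lambda>f. cmod (T f))"
        by (simp add: comp_def)
      then show ?thesis
        by (subst (asm) continuous_map_graded_iff[OF E r r_mono seminorm_on_subset[OF semi E_subset_limit_space]])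
          (assumption | rule n)+
    qed
    then show "(\<lambda>f. cmod (T f)) \<in> limit_seminorms" using semi by (simp add: limit_seminorms_def)
  next
    assume T: "(\<lambda>f. cmod (T f)) \<in> limit_seminorms"
    have "\<exists>Q \<epsilon>. finite Q \<and> Q \<subseteq> limit_seminorms \<and> 0 < \<epsilon> \<and>
        {g \<in> limit_space. \<forall>p\<in>Q. p (\<lambda>x. g x - f x) < \<epsilon>} \<subseteq> {f \<in> limit_space. T f \<in> V}"
      if V: "open V" and f: "f \<in> limit_space" "T f \<in> V" for f V
    proof -
      obtain e where e: "e > 0" "\<And>y. dist y (T f) < e \<Longrightarrow> y \<in> V"
        using V f(2) unfolding open_dist by blast
      have "T g \<in> V" if g: "g \<in> limit_space" "cmod (T (\<lambda>x. g x - f x)) < e" for g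
      proof (rule e(2))
        have "T (\<lambda>x. g x + - 1 * f x) = T g + T (\<lambda>x. - 1 * f x)"
          by (rule add[rule_format, OF g(1) linear_space_scale[OF linear_space_limit_space f(1)]])
        also have "T (\<lambda>x. - 1 * f x) = - 1 * T f" using scale f(1) by blast
        finally show "dist (T g) (T f) < e" using g(2) by (simp add: dist_norm)
      qed
      then show ?thesis
        using e(1) T by (intro exI[of _ "{\<lambda>f. cmod (T f)}"] exI[of _ e]) auto
    qed
    then show "continuous_map limit_top euclidean T"
      unfolding continuous_map_def limit_top_eq openin_seminorm_topology topspace_seminorm_topology
      by auto
  qed
  then show ?thesis unfolding continuous_dual_def topspace_limit_top by blast
qed

lemma dual_add: "T \<in> continuous_dual limit_top \<Longrightarrow> f \<in> limit_space \<Longrightarrow> g \<in> limit_space \<Longrightarrow> T (\<lambda>x. f x + g x) = T f + T g"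
  and dual_scale: "T \<in> continuous_dual limit_top \<Longrightarrow> f \<in> limit_space \<Longrightarrow> T (\<lambda>x. c * f x) = c * T f"
  and dual_in_limit_seminorms: "T \<in> continuous_dual limit_top \<Longrightarrow> (\<lambda>f. cmod (T f)) \<in> limit_seminorms"
  by (auto simp: dual_iff)

lemma linear_space_dual: "linear_space (continuous_dual limit_top)"
proof -
  have "continuous_map limit_top euclidean (\<lambda>f. c * T f)" if "continuous_map limit_top euclidean T"
    for c :: complex and T
    using that by (simp add: continuous_map_atin tendsto_mult_left)
  then show ?thesis
    unfolding linear_space_def continuous_dual_def
    by (auto intro: continuous_map_add simp: algebra_simps)
qed

definition dual_seminorms where
  "dual_seminorms = {\<lambda>T. SUP f\<in>B. cmod (T f) |B. tvs_bounded limit_top B \<and> B \<noteq> {}}"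

lemma bdd_above_dual: "T \<in> continuous_dual limit_top \<Longrightarrow> tvs_bounded limit_top B \<Longrightarrow> bdd_above ((\<lambda>f. cmod (T f)) ` B)"
  using tvs_bounded_limit_top_le[OF _ dual_in_limit_seminorms, of B T] by (auto intro: bdd_aboveI2)

lemma dual_seminorm_upper:
  "T \<in> continuous_dual limit_top \<Longrightarrow> tvs_bounded limit_top B \<Longrightarrow> f \<in> B \<Longrightarrow> cmod (T f) \<le> (SUP f\<in>B. cmod (T f))"
  by (rule cSUP_upper[OF _ bdd_above_dual])

lemma dual_seminorm: "p \<in> dual_seminorms \<Longrightarrow> seminorm_on (continuous_dual limit_top) p"
  unfolding dual_seminorms_def
proof clarify
  fix B assume B: "tvs_bounded limit_top B" "B \<noteq> {}"
  show "seminorm_on (continuous_dual limit_top) (\<lambda>T. SUP f\<in>B. cmod (T f))"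
    by (rule seminorm_on_SUP[OF linear_space_dual _ B(2) bdd_above_dual[OF _ B(1)]])
      (auto simp: seminorm_on_def norm_triangle_ineq norm_mult)
qed

lemma strong_dual_eq: "strong_dual limit_top = seminorm_topology (continuous_dual limit_top) dual_seminorms"
  by (simp add: strong_dual_def dual_seminorms_def)

lemma tvs_bounded_dual: "tvs_bounded (strong_dual limit_top) D \<longleftrightarrow>
    D \<subseteq> continuous_dual limit_top \<and> (\<forall>p\<in>dual_seminorms. \<exists>C. \<forall>T\<in>D. p T \<le> C)"
  unfolding strong_dual_eq
  by (rule tvs_bounded_seminorm_topology_iff[OF linear_space_dual dual_seminorm])

section \<open>Hypocontinuity of the multiplication\<close>

definition mult where
  "mult f T = (\<lambda>g. if g \<in> limit_space then T (\<lambda>x. f x * g x) else 0)"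

lemma mult_in_dual:
  assumes f: "f \<in> limit_space" and T: "T \<in> continuous_dual limit_top"
  shows "mult f T \<in> continuous_dual limit_top"
  unfolding dual_iff
proof (intro conjI ballI allI impI)
  have p: "(\<lambda>g. cmod (T (\<lambda>x. f x * g x))) \<in> limit_seminorms"
    using mult_in_limit_seminorms[OF f dual_in_limit_seminorms[OF T]] .
  show "(\<lambda>g. cmod (mult f T g)) \<in> limit_seminorms"
  proof (rule in_limit_seminorms_mono[OF p])
    show "seminorm_on limit_space (\<lambda>g. cmod (mult f T g))"
      using limit_seminorms_seminorm[OF p] linear_space_add[OF linear_space_limit_space] linear_space_scale[OF linear_space_limit_space]
      by (auto simp: seminorm_on_def mult_def)
  qed (simp add: mult_def)
next
  fix g h assume g: "g \<in> limit_space" and h: "h \<in> limit_space"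
  show "mult f T (\<lambda>x. g x + h x) = mult f T g + mult f T h"
    using dual_add[OF T mult_limit_space[OF f g] mult_limit_space[OF f h]] linear_space_add[OF linear_space_limit_space g h] g h
    by (simp add: mult_def distrib_left)
next
  fix g c assume g: "g \<in> limit_space"
  show "mult f T (\<lambda>x. c * g x) = c * mult f T g"
    using dual_scale[OF T mult_limit_space[OF f g], of c] linear_space_scale[OF linear_space_limit_space g, of c] g
    by (simp add: mult_def mult_ac)
qed (simp add: mult_def)

lemma linear_map_mult_right: "f \<in> limit_space \<Longrightarrow> linear_map (continuous_dual limit_top) (continuous_dual limit_top) (mult f)"
  using mult_in_dual by (auto simp: linear_map_def mult_def)

lemma linear_map_mult_left:
  assumes T: "T \<in> continuous_dual limit_top"
  shows "linear_map limit_space (continuous_dual limit_top) (\<lambda>f. mult f T)"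
  unfolding linear_map_def
proof (intro conjI ballI allI ext)
  show "(\<lambda>f. mult f T) \<in> limit_space \<rightarrow> continuous_dual limit_top" using mult_in_dual[OF _ T] by blast
  fix f g assume f: "f \<in> limit_space"
  show "mult (\<lambda>x. c * f x) T g = c * mult f T g" for c
    using dual_scale[OF T mult_limit_space[OF f], of g c] by (simp add: mult_def mult_ac)
  show "mult (\<lambda>x. f x + h x) T g = mult f T g + mult h T g" if h: "h \<in> limit_space" for h
    using dual_add[OF T mult_limit_space[OF f] mult_limit_space[OF h], of g g] by (simp add: mult_def distrib_right)
qed

lemma equicontinuous_mult_right:
  assumes A: "tvs_bounded limit_top A"
  shows "equicontinuous (strong_dual limit_top) (strong_dual limit_top) ((\<lambda>f T. mult f T) ` A)"
  unfolding strong_dual_eq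
proof (rule equicontinuous_seminorm_topology[OF linear_space_dual dual_seminorm])
  have AU: "A \<subseteq> limit_space" using A by (simp add: tvs_bounded_limit_top)
  show "linear_map (continuous_dual limit_top) (continuous_dual limit_top) h" if "h \<in> (\<lambda>f T. mult f T) ` A" for h
    using that AU linear_map_mult_right by auto
  fix q assume q: "q \<in> dual_seminorms"
  then obtain B where B: "tvs_bounded limit_top B" "B \<noteq> {}" "q = (\<lambda>T. SUP f\<in>B. cmod (T f))"
    by (auto simp: dual_seminorms_def)
  let ?AB = "{\<lambda>x. f x * g x |f g. f \<in> A \<and> g \<in> B}"
  show "\<exists>p\<in>dual_seminorms. \<exists>C. \<forall>h\<in>(\<lambda>f T. mult f T) ` A. \<forall>T\<in>continuous_dual limit_top. q (h T) \<le> C * p T"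
  \<comment> \<open>For empty \<open>A\<close> the product set is empty and defines no seminorm of
    the dual; the estimate is then vacuous and \<open>q\<close> itself serves.\<close>
  proof (cases "A = {}")
    case True
    then show ?thesis using q by auto
  next
    case False
    have AB: "tvs_bounded limit_top ?AB" by (rule tvs_bounded_mult[OF A B(1)])
    have "q (mult f T) \<le> 1 * (SUP h\<in>?AB. cmod (T h))" if f: "f \<in> A" and T: "T \<in> continuous_dual limit_top" for f T
      unfolding B(3) mult_1
    proof (rule cSUP_least[OF B(2)])
      fix g assume g: "g \<in> B"
      then have "g \<in> limit_space" using B(1) by (auto simp: tvs_bounded_limit_top)
      then show "cmod (mult f T g) \<le> (SUP h\<in>?AB. cmod (T h))"
        using f g by (auto simp: mult_def intro!: dual_seminorm_upper[OF T AB])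
    qed
    moreover have "(\<lambda>T. SUP h\<in>?AB. cmod (T h)) \<in> dual_seminorms"
      using AB False B(2) by (auto simp: dual_seminorms_def)
    ultimately show ?thesis by (intro bexI exI[of _ 1]) auto
  qed
qed

lemma equicontinuous_mult_left:
  assumes D: "tvs_bounded (strong_dual limit_top) D"
  shows "equicontinuous limit_top (strong_dual limit_top) ((\<lambda>T f. mult f T) ` D)"
proof -
  have D': "D \<subseteq> continuous_dual limit_top" "\<And>p. p \<in> dual_seminorms \<Longrightarrow> \<exists>C. \<forall>T\<in>D. p T \<le> C"
    using D by (simp_all add: tvs_bounded_dual)
  have lin: "linear_map limit_space (continuous_dual limit_top) h" if "h \<in> (\<lambda>T f. mult f T) ` D" for h
    using that D'(1) linear_map_mult_left by auto
  have le: "\<exists>p\<in>limit_seminorms. \<exists>C. \<forall>h\<in>(\<lambda>T f. mult f T) ` D. \<forall>f\<in>limit_space. q (h f) \<le> C * p f"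
    if "q \<in> dual_seminorms" for q
  proof -
    from that obtain B where B: "tvs_bounded limit_top B" "B \<noteq> {}" "q = (\<lambda>T. SUP f\<in>B. cmod (T f))"
      by (auto simp: dual_seminorms_def)
    have BU: "B \<subseteq> limit_space" using B(1) by (simp add: tvs_bounded_limit_top)
    \<comment> \<open>One supremum over both \<open>T\<close> and \<open>g\<close>, so that a single
      appeal to barrelledness suffices.\<close>
    define p where "p = (\<lambda>f. SUP (T, g)\<in>D \<times> B. cmod (T (\<lambda>x. f x * g x)))"
    \<comment> \<open>For one \<open>f\<close> the set \<open>f B\<close> is bounded, being the
      product of a singleton with \<open>B\<close>, and a strongly bounded \<open>D\<close> is
      uniformly bounded on it.\<close>
    have bdd: "\<exists>C. \<forall>(T, g)\<in>D \<times> B. cmod (T (\<lambda>x. f x * g x)) \<le> C" if f: "f \<in> limit_space" for f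
    proof -
      let ?fB = "{\<lambda>x. f x * g x |f' g. f' \<in> {f} \<and> g \<in> B}"
      have "tvs_bounded limit_top {f}" using f by (auto simp: tvs_bounded_limit_top)
      from tvs_bounded_mult[OF this B(1)]
      have fB: "tvs_bounded limit_top ?fB" by simp
      then have "(\<lambda>T. SUP h\<in>?fB. cmod (T h)) \<in> dual_seminorms"
        using B(2) by (auto simp: dual_seminorms_def)
      from D'(2)[OF this] obtain C where C: "\<And>T. T \<in> D \<Longrightarrow> (SUP h\<in>?fB. cmod (T h)) \<le> C" by blast
      have "cmod (T (\<lambda>x. f x * g x)) \<le> C" if "T \<in> D" "g \<in> B" for T g
        using dual_seminorm_upper[OF _ fB, of T "\<lambda>x. f x * g x"] C[OF that(1)] that D'(1) by fastforce
      then show ?thesis by blast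
    qed
    show ?thesis
    proof (cases "D = {}")
      case True
      have "(\<lambda>f. 0) \<in> limit_seminorms" by (auto simp: limit_seminorms_def seminorm_on_def intro!: exI[of _ 0])
      with True show ?thesis by auto
    next
      case False
      have "p \<in> limit_seminorms"
        unfolding p_def
      proof (rule SUP_in_limit_seminorms)
        fix i assume "i \<in> D \<times> B"
        then obtain T g where i: "i = (T, g)" "T \<in> continuous_dual limit_top" "g \<in> limit_space" using D'(1) BU by blast
        from mult_in_limit_seminorms[OF i(3) dual_in_limit_seminorms[OF i(2)]]
        show "(\<lambda>f. case i of (T, g) \<Rightarrow> cmod (T (\<lambda>x. f x * g x))) \<in> limit_seminorms"
          by (simp add: i(1) mult.commute)
      qed (use False B(2) bdd in auto)
      moreover have "q (mult f T) \<le> 1 * p f" if T: "T \<in> D" and f: "f \<in> limit_space" for f T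
        unfolding B(3) mult_1
      proof (rule cSUP_least[OF B(2)])
        fix g assume g: "g \<in> B"
        have "bdd_above ((\<lambda>(T, g). cmod (T (\<lambda>x. f x * g x))) ` (D \<times> B))"
          using bdd[OF f] by (auto simp: bdd_above_def)
        from cSUP_upper[OF _ this, of "(T, g)"] show "cmod (mult f T g) \<le> p f"
          using T g BU by (auto simp: mult_def p_def)
      qed
      ultimately show ?thesis by (intro bexI exI[of _ 1]) auto
    qed
  qed
  from equicontinuous_seminorm_topology[OF linear_space_limit_space limit_seminorms_seminorm lin le] show ?thesis
    by (simp only: strong_dual_eq limit_top_eq[symmetric])
qed

theorem hypocontinuous_mult:
  "bilinear_map (topspace limit_top) (topspace (strong_dual limit_top)) (topspace (strong_dual limit_top)) mult"
  "separately_continuous limit_top (strong_dual limit_top) (strong_dual limit_top) mult"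
  "hypocontinuous limit_top (strong_dual limit_top) (strong_dual limit_top) mult"
proof -
  show "bilinear_map (topspace limit_top) (topspace (strong_dual limit_top)) (topspace (strong_dual limit_top)) mult"
    using linear_map_mult_left linear_map_mult_right
    by (auto simp: bilinear_map_def strong_dual_eq topspace_limit_top)
  show "hypocontinuous limit_top (strong_dual limit_top) (strong_dual limit_top) mult"
    using equicontinuous_mult_left equicontinuous_mult_right by (simp add: hypocontinuous_def)
  have "continuous_map (strong_dual limit_top) (strong_dual limit_top) (mult f)" if "f \<in> limit_space" for f
  proof -
    have "tvs_bounded limit_top {f}" using that by (auto simp: tvs_bounded_limit_top)
    from equicontinuous_mult_right[OF this] show ?thesis
      by (simp add: equicontinuous_def continuous_linear_maps_def)
  qed
  moreover have "continuous_map limit_top (strong_dual limit_top) (\<lambda>f. mult f T)" if "T \<in> continuous_dual limit_top" for T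
  proof -
    have "tvs_bounded (strong_dual limit_top) {T}"
      using that by (auto simp: tvs_bounded_dual)
    from equicontinuous_mult_left[OF this] show ?thesis
      by (simp add: equicontinuous_def continuous_linear_maps_def)
  qed
  ultimately show "separately_continuous limit_top (strong_dual limit_top) (strong_dual limit_top) mult"
    by (simp add: separately_continuous_def strong_dual_eq topspace_limit_top)
qed

end

section \<open>Iterated partial derivatives\<close>

lemma partial_eqI:
  fixes f :: "real ^ 'n::finite \<Rightarrow> complex"
  assumes "(f has_derivative D) (at x)"
  shows "partial i f x = D (axis i 1)"
proof -
  have D: "bounded_linear D" using assms by (rule has_derivative_bounded_linear)
  have "((\<lambda>t. x + t *\<^sub>R axis i 1) has_derivative (\<lambda>t. t *\<^sub>R axis i 1)) (at (0::real))"
    by (auto intro!: derivative_eq_intros)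
  then have "((\<lambda>t. f (x + t *\<^sub>R axis i 1)) has_derivative (\<lambda>t. D (t *\<^sub>R axis i 1))) (at (0::real))"
    by (rule has_derivative_compose) (simp add: assms)
  then have "((\<lambda>t. f (x + t *\<^sub>R axis i 1)) has_vector_derivative D (axis i 1)) (at (0::real))"
    using D by (simp add: has_vector_derivative_def linear_cmul bounded_linear.linear)
  then show ?thesis
    unfolding partial_def by (rule vector_derivative_at)
qed

lemma has_derivative_partial:
  fixes f :: "real ^ 'n::finite \<Rightarrow> complex"
  assumes "f differentiable (at x)"
  shows "(f has_derivative (\<lambda>v. \<Sum>i\<in>UNIV. (v $ i) *\<^sub>R partial i f x)) (at x)"
proof -
  obtain D where D: "(f has_derivative D) (at x)" using assms unfolding differentiable_def by blast
  have lin: "linear D" using D has_derivative_linear by blast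
  have "D v = (\<Sum>i\<in>UNIV. (v $ i) *\<^sub>R partial i f x)" for v
  proof -
    have "D v = D (\<Sum>i\<in>UNIV. (v $ i) *\<^sub>R axis i 1)"
      by (simp only: basis_expansion scalar_mult_eq_scaleR[symmetric])
    also have "\<dots> = (\<Sum>i\<in>UNIV. (v $ i) *\<^sub>R partial i f x)"
      using partial_eqI[OF D] by (simp add: linear_sum[OF lin] linear_cmul[OF lin])
    finally show ?thesis .
  qed
  then have "D = (\<lambda>v. \<Sum>i\<in>UNIV. (v $ i) *\<^sub>R partial i f x)" by (rule ext)
  with D show ?thesis by simp
qed

lemma has_vector_derivative_partial:
  fixes f :: "real ^ 'n::finite \<Rightarrow> complex"
  assumes "f differentiable_on UNIV"
  shows "((\<lambda>t. f (x + t *\<^sub>R axis i 1)) has_vector_derivative partial i f (x + s *\<^sub>R axis i 1))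
    (at s within S)"
proof -
  let ?y = "x + s *\<^sub>R axis i 1"
  obtain D where D: "(f has_derivative D) (at ?y)"
    using assms unfolding differentiable_on_def differentiable_def by auto
  have lin: "linear D" using D has_derivative_linear by blast
  have "((\<lambda>t. x + t *\<^sub>R axis i 1) has_derivative (\<lambda>t. t *\<^sub>R axis i 1)) (at s within S)"
    by (auto intro!: derivative_eq_intros)
  then have "((\<lambda>t. f (x + t *\<^sub>R axis i 1)) has_derivative (\<lambda>t. D (t *\<^sub>R axis i 1))) (at s within S)"
    by (rule has_derivative_compose) (rule D)
  then show ?thesis
    using partial_eqI[OF D] by (simp add: has_vector_derivative_def linear_cmul[OF lin])
qed

lemma partial_add:
  assumes "f differentiable_on UNIV" "g differentiable_on UNIV"
  shows "partial i (\<lambda>x. f x + g x) = (\<lambda>x. partial i f x + partial i g x)"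
proof
  fix x
  obtain D D' where D: "(f has_derivative D) (at x)" and D': "(g has_derivative D') (at x)"
    using assms unfolding differentiable_on_def differentiable_def by (metis UNIV_I)
  show "partial i (\<lambda>x. f x + g x) x = partial i f x + partial i g x"
    using partial_eqI[OF D] partial_eqI[OF D'] partial_eqI[OF has_derivative_add[OF D D']] by simp
qed

lemma partial_mult:
  assumes "f differentiable_on UNIV" "g differentiable_on UNIV"
  shows "partial i (\<lambda>x. f x * g x) = (\<lambda>x. partial i f x * g x + f x * partial i g x)"
proof
  fix x
  obtain D D' where D: "(f has_derivative D) (at x)" and D': "(g has_derivative D') (at x)"
    using assms unfolding differentiable_on_def differentiable_def by (metis UNIV_I)
  show "partial i (\<lambda>x. f x * g x) x = partial i f x * g x + f x * partial i g x"
    using partial_eqI[OF D] partial_eqI[OF D'] partial_eqI[OF has_derivative_mult[OF D D']]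
    by (simp add: add.commute)
qed

text \<open>Write the increment of \<open>f\<close> in direction \<open>j\<close> as an integral of
  \<open>partial j f\<close>, differentiate under the integral sign in direction \<open>i\<close>,
  and then differentiate the resulting integral in its upper limit. Only the mixed derivative under
  the integral has to be continuous.\<close>

lemma partial_commute:
  fixes f :: "real ^ 'n::finite \<Rightarrow> complex"
  assumes f: "f differentiable_on UNIV"
    and fi: "partial i f differentiable_on UNIV" and fj: "partial j f differentiable_on UNIV"
    and c: "continuous_on UNIV (partial i (partial j f))"
  shows "partial i (partial j f) = partial j (partial i f)"
proof
  fix x
  let ?ei = "axis i 1 :: real ^ 'n" and ?ej = "axis j 1 :: real ^ 'n"
  have eq: "partial i f (x + t *\<^sub>R ?ej) - partial i f x
      = integral {0..t} (\<lambda>\<tau>. partial i (partial j f) (x + \<tau> *\<^sub>R ?ej))" if t: "0 \<le> t" for t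
  proof -
    have int: "((\<lambda>\<tau>. partial j f (x + s *\<^sub>R ?ei + \<tau> *\<^sub>R ?ej)) has_integral
        (f (x + s *\<^sub>R ?ei + t *\<^sub>R ?ej) - f (x + s *\<^sub>R ?ei))) {0..t}" for s
    proof -
      have "\<And>\<tau>. \<tau> \<in> {0..t} \<Longrightarrow> ((\<lambda>\<tau>. f (x + s *\<^sub>R ?ei + \<tau> *\<^sub>R ?ej)) has_vector_derivative
          partial j f (x + s *\<^sub>R ?ei + \<tau> *\<^sub>R ?ej)) (at \<tau> within {0..t})"
        by (rule has_vector_derivative_partial[OF f])
      from fundamental_theorem_of_calculus[OF t this] show ?thesis by simp
    qed
    have 1: "((\<lambda>s. integral (cbox 0 t) (\<lambda>\<tau>. partial j f (x + s *\<^sub>R ?ei + \<tau> *\<^sub>R ?ej)))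
        has_vector_derivative
          integral (cbox 0 t) (\<lambda>\<tau>. partial i (partial j f) (x + 0 *\<^sub>R ?ei + \<tau> *\<^sub>R ?ej)))
        (at 0 within UNIV)"
    proof (rule leibniz_rule_vector_derivative)
      fix s \<tau> :: real
      show "((\<lambda>s. partial j f (x + s *\<^sub>R ?ei + \<tau> *\<^sub>R ?ej)) has_vector_derivative
          partial i (partial j f) (x + s *\<^sub>R ?ei + \<tau> *\<^sub>R ?ej)) (at s within UNIV)"
        using has_vector_derivative_partial[OF fj, of "x + \<tau> *\<^sub>R ?ej" i s UNIV]
        by (simp add: add_ac)
    next
      fix s :: real
      show "(\<lambda>\<tau>. partial j f (x + s *\<^sub>R ?ei + \<tau> *\<^sub>R ?ej)) integrable_on cbox 0 t"
        using int[of s] by (auto simp: integrable_on_def)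
    next
      show "continuous_on (UNIV \<times> cbox 0 t)
          (\<lambda>(s, \<tau>). partial i (partial j f) (x + s *\<^sub>R ?ei + \<tau> *\<^sub>R ?ej))"
        unfolding case_prod_unfold
        by (intro continuous_on_compose2[OF c] continuous_intros) auto
    qed auto
    have 2: "((\<lambda>s. f (x + s *\<^sub>R ?ei + t *\<^sub>R ?ej) - f (x + s *\<^sub>R ?ei)) has_vector_derivative
        partial i f (x + t *\<^sub>R ?ej) - partial i f x) (at 0)"
      using has_vector_derivative_diff[OF
          has_vector_derivative_partial[OF f, of "x + t *\<^sub>R ?ej" i 0 UNIV]
          has_vector_derivative_partial[OF f, of x i 0 UNIV]]
      by (simp add: add_ac)
    have "integral (cbox 0 t) (\<lambda>\<tau>. partial j f (x + s *\<^sub>R ?ei + \<tau> *\<^sub>R ?ej))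
        = f (x + s *\<^sub>R ?ei + t *\<^sub>R ?ej) - f (x + s *\<^sub>R ?ei)" for s
      using int[of s] by (simp add: integral_unique)
    with 1 have "((\<lambda>s. f (x + s *\<^sub>R ?ei + t *\<^sub>R ?ej) - f (x + s *\<^sub>R ?ei)) has_vector_derivative
        integral {0..t} (\<lambda>\<tau>. partial i (partial j f) (x + \<tau> *\<^sub>R ?ej))) (at 0)"
      by simp
    from vector_derivative_unique_at[OF 2 this] show ?thesis .
  qed
  have 3: "((\<lambda>t. integral {0..t} (\<lambda>\<tau>. partial i (partial j f) (x + \<tau> *\<^sub>R ?ej)))
      has_vector_derivative partial i (partial j f) (x + 0 *\<^sub>R ?ej)) (at 0 within {0..1})"
    by (rule integral_has_vector_derivative)
      (auto intro!: continuous_on_compose2[OF c] continuous_intros)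
  have "((\<lambda>t. partial i f (x + t *\<^sub>R ?ej) - partial i f x) has_vector_derivative
      partial j (partial i f) (x + 0 *\<^sub>R ?ej) - 0) (at 0 within {0..1})"
    by (intro has_vector_derivative_diff has_vector_derivative_partial[OF fi]
        has_vector_derivative_const)
  then have "((\<lambda>t. partial i f (x + t *\<^sub>R ?ej) - partial i f x) has_vector_derivative
      partial j (partial i f) x) (at 0 within {0..1})"
    by simp
  then have 4: "((\<lambda>t. integral {0..t} (\<lambda>\<tau>. partial i (partial j f) (x + \<tau> *\<^sub>R ?ej)))
      has_vector_derivative partial j (partial i f) x) (at 0 within {0..1})"
    by (rule has_vector_derivative_transform[rotated 2]) (auto simp: eq)
  \<comment> \<open>The integral formula was shown for \<open>t \<ge> 0\<close>, so both derivatives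
    at 0 are one-sided; they are unique because 0 is a limit point of the interval.\<close>
  have "at (0::real) within {0..1} \<noteq> bot"
    by (simp add: trivial_limit_within islimpt_Icc)
  from vector_derivative_unique_within[OF this 3 4]
  show "partial i (partial j f) x = partial j (partial i f) x" by simp
qed

section \<open>Smooth functions and the order of differentiation\<close>

lemma smooth_differentiable: "smooth f \<Longrightarrow> foldr partial is f differentiable_on UNIV"
  by (simp add: smooth_def)

lemma smooth_foldr_partial: "smooth f \<Longrightarrow> smooth (foldr partial is f)"
  unfolding smooth_def by (metis foldr_append comp_def)

lemma smooth_partial_commute:
  assumes "smooth f"
  shows "partial i (partial j f) = partial j (partial i f)"
proof (rule partial_commute)
  show "continuous_on UNIV (partial i (partial j f))"
    using smooth_differentiable[OF assms, of "[i, j]"]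
    by (simp add: differentiable_imp_continuous_on)
qed (use smooth_differentiable[OF assms, of "[]"] smooth_differentiable[OF assms, of "[i]"]
  smooth_differentiable[OF assms, of "[j]"] in simp_all)

lemma foldr_partial_partial:
  assumes "smooth f"
  shows "foldr partial is (partial i f) = partial i (foldr partial is f)"
proof (induction "is")
  case (Cons j js)
  have "partial j (partial i (foldr partial js f)) = partial i (partial j (foldr partial js f))"
    by (rule smooth_partial_commute[OF smooth_foldr_partial[OF assms]])
  with Cons show ?case by simp
qed simp

text \<open>Commutation moves the head of the first list to the place where it occurs in the
  second.\<close>

lemma foldr_partial_mset:
  assumes "smooth f" "mset is = mset js"
  shows "foldr partial is f = foldr partial js f"
  using assms(2)
proof (induction "is" arbitrary: js)
  case (Cons i "is")
  then have "i \<in> set js" by (metis list.set_intros(1) mset_eq_setD)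
  then obtain ks ls where js: "js = ks @ i # ls" by (meson split_list)
  with Cons.prems have "mset is = mset (ks @ ls)" by simp
  then have "foldr partial is f = foldr partial ks (foldr partial ls f)"
    using Cons.IH[of "ks @ ls"] by simp
  then show ?case
    using foldr_partial_partial[OF smooth_foldr_partial[OF assms(1)], of ks i ls] js by simp
qed simp

lemma coordinates: "distinct (coordinates :: 'n::finite list)" "set (coordinates :: 'n list) = UNIV"
proof -
  have "\<exists>is :: 'n list. distinct is \<and> set is = UNIV"
    using finite_distinct_list[of "UNIV :: 'n set"] by auto
  from someI_ex[OF this]
  show "distinct (coordinates :: 'n::finite list)" "set (coordinates :: 'n list) = UNIV"
    unfolding coordinates_def by auto
qed

lemma mderiv_eq_foldr:
  "mderiv \<alpha> f = foldr partial (concat (map (\<lambda>i. replicate (\<alpha> i) i) coordinates)) f"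
proof -
  have "foldr partial (replicate k i) g = (partial i ^^ k) g" for k i and g :: "real ^ 'n \<Rightarrow> complex"
    by (induction k) auto
  then have "foldr (\<lambda>i. partial i ^^ \<alpha> i) is f
      = foldr partial (concat (map (\<lambda>i. replicate (\<alpha> i) i) is)) f" for "is"
    by (induction "is") auto
  then show ?thesis unfolding mderiv_def .
qed

lemma length_multiindex_list:
  "length (concat (map (\<lambda>i. replicate (\<alpha> i) i) (coordinates :: 'n::finite list))) = mabs \<alpha>"
proof -
  have "length (concat (map (\<lambda>i. replicate (\<alpha> i) i) (coordinates :: 'n list))) =
      sum_list (map \<alpha> coordinates)"
    by (simp add: length_concat comp_def)
  also have "\<dots> = sum \<alpha> (set coordinates)"
    by (rule sum_list_distinct_conv_sum_set[OF coordinates(1)])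
  finally show ?thesis by (simp add: coordinates(2) mabs_def)
qed

text \<open>The bridge from lists to multi-indices: later estimates are proved by induction on lists
  and depend on a list only through its length.\<close>

lemma foldr_partial_eq_mderiv:
  fixes f :: "real ^ 'n::finite \<Rightarrow> complex"
  assumes "smooth f"
  shows "foldr partial is f = mderiv (count (mset is)) f" "mabs (count (mset is)) = length is"
proof -
  let ?js = "concat (map (\<lambda>i. replicate (count (mset is) i) i) (coordinates :: 'n list))"
  have "count (mset (concat (map (\<lambda>i. replicate (\<alpha> i) i) (ks :: 'n list)))) k =
      (if k \<in> set ks then \<alpha> k else 0)" if "distinct ks" for ks k and \<alpha> :: "'n \<Rightarrow> nat"
    using that by (induction ks) auto
  from this[OF coordinates(1)] have m: "mset ?js = mset is"
    by (intro multiset_eqI) (simp add: coordinates(2))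
  show "foldr partial is f = mderiv (count (mset is)) f"
    unfolding mderiv_eq_foldr by (rule foldr_partial_mset[OF assms m[symmetric]])
  show "mabs (count (mset is)) = length is"
    using m length_multiindex_list[of "count (mset is)"] by (metis mset_eq_length)
qed

section \<open>Sums, multiples and products of smooth functions\<close>

lemma foldr_partial_add:
  assumes "smooth f" "smooth g"
  shows "foldr partial is (\<lambda>x. f x + g x) = (\<lambda>x. foldr partial is f x + foldr partial is g x)"
proof (induction "is")
  case (Cons i "is")
  then show ?case
    by (simp add: partial_add smooth_differentiable[OF assms(1)] smooth_differentiable[OF assms(2)])
qed simp

lemma smooth_add: "smooth f \<Longrightarrow> smooth g \<Longrightarrow> smooth (\<lambda>x. f x + g x)"
  by (simp add: foldr_partial_add smooth_def[of "\<lambda>x. f x + g x"] smooth_differentiable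
      differentiable_on_add)

lemma partial_const: "partial i (\<lambda>x. c) = (\<lambda>x. 0)"
  using partial_eqI[OF has_derivative_const] by blast

lemma foldr_partial_cmult:
  assumes "smooth f"
  shows "foldr partial is (\<lambda>x. c * f x) = (\<lambda>x. c * foldr partial is f x)"
proof (induction "is")
  case (Cons i "is")
  then show ?case
    by (simp add: partial_mult smooth_differentiable[OF assms] partial_const)
qed simp

lemma smooth_cmult: "smooth f \<Longrightarrow> smooth (\<lambda>x. c * f x)"
  by (simp add: foldr_partial_cmult smooth_def[of "\<lambda>x. c * f x"] smooth_differentiable
      differentiable_on_mult)

lemma foldr_partial_0: "foldr partial is (\<lambda>x. 0) = (\<lambda>x. 0)"
  by (induction "is") (auto simp: partial_const)

lemma smooth_0: "smooth (\<lambda>x. 0)"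
  by (simp add: smooth_def foldr_partial_0)

lemma smooth_diff: "smooth f \<Longrightarrow> smooth g \<Longrightarrow> smooth (\<lambda>x. f x - g x)"
  using smooth_add[OF _ smooth_cmult[of g "-1"]] by simp

lemma foldr_partial_diff:
  assumes "smooth f" "smooth g"
  shows "foldr partial is (\<lambda>x. f x - g x) = (\<lambda>x. foldr partial is f x - foldr partial is g x)"
  using foldr_partial_add[OF assms(1) smooth_cmult[OF assms(2), of "-1"]]
  using foldr_partial_cmult[OF assms(2), of "is" "-1"] by simp

text \<open>All ways of sending each entry of the list to the first or to the second factor, counted
  with multiplicity. Repetitions take the place of binomial coefficients.\<close>

primrec leibniz_pairs :: "'a list \<Rightarrow> ('a list \<times> 'a list) list" where
  "leibniz_pairs [] = [([], [])]"
| "leibniz_pairs (i # is) = map (\<lambda>(js, ks). (i # js, ks)) (leibniz_pairs is) @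
     map (\<lambda>(js, ks). (js, i # ks)) (leibniz_pairs is)"

lemma length_leibniz_pairs: "length (leibniz_pairs is) = 2 ^ length is"
  by (induction "is") auto

lemma leibniz_pairs_length:
  "(js, ks) \<in> set (leibniz_pairs is) \<Longrightarrow> length js + length ks = length is"
  by (induction "is" arbitrary: js ks) auto

lemma leibniz_sum_differentiable:
  assumes "smooth f" "smooth g"
  shows "(\<lambda>x. \<Sum>(js, ks)\<leftarrow>ps. foldr partial js f x * foldr partial ks g x) differentiable_on UNIV"
proof (induction ps)
  case (Cons p ps)
  obtain js ks where "p = (js, ks)" by (cases p)
  then show ?case
    using Cons smooth_differentiable[OF assms(1), of js] smooth_differentiable[OF assms(2), of ks]
    by (simp add: differentiable_on_add differentiable_on_mult)
qed simp

lemma foldr_partial_mult: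
  assumes "smooth f" "smooth g"
  shows "foldr partial is (\<lambda>x. f x * g x) =
    (\<lambda>x. \<Sum>(js, ks)\<leftarrow>leibniz_pairs is. foldr partial js f x * foldr partial ks g x)"
proof (induction "is")
  case (Cons i "is")
  have "partial i (\<lambda>x. \<Sum>(js, ks)\<leftarrow>ps. foldr partial js f x * foldr partial ks g x) =
      (\<lambda>x. (\<Sum>(js, ks)\<leftarrow>map (\<lambda>(js, ks). (i # js, ks)) ps. foldr partial js f x * foldr partial ks g x) +
        (\<Sum>(js, ks)\<leftarrow>map (\<lambda>(js, ks). (js, i # ks)) ps. foldr partial js f x * foldr partial ks g x))"
    for ps
  proof (induction ps)
    case (Cons p ps)
    obtain js ks where p: "p = (js, ks)" by (cases p)
    have d: "(\<lambda>x. foldr partial js f x * foldr partial ks g x) differentiable_on UNIV"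
      by (intro differentiable_on_mult smooth_differentiable assms)
    show ?case
      using partial_add[OF d leibniz_sum_differentiable[OF assms, of ps], of i] Cons.IH p
        partial_mult[OF smooth_differentiable[OF assms(1)] smooth_differentiable[OF assms(2)]]
      by (simp add: algebra_simps)
  qed (simp add: partial_const)
  with Cons show ?case by simp
qed simp

lemma smooth_mult: "smooth f \<Longrightarrow> smooth g \<Longrightarrow> smooth (\<lambda>x. f x * g x)"
  by (simp add: foldr_partial_mult smooth_def[of "\<lambda>x. f x * g x"] leibniz_sum_differentiable)

text \<open>Every Leibniz term splits the same total length, so \<open>c (length is)\<close> bounds
  each of them, and \<open>2 ^ length is\<close> counts them.\<close>

lemma norm_foldr_partial_mult_le:
  assumes "smooth f" "smooth g"
    and a: "\<And>js. cmod (foldr partial js f x) \<le> a (length js)"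
    and b: "\<And>ks. cmod (foldr partial ks g x) \<le> b (length ks)"
    and c: "\<And>i j. a i * b j \<le> c (i + j)"
  shows "cmod (foldr partial is (\<lambda>x. f x * g x) x) \<le> 2 ^ length is * c (length is)"
proof -
  have *: "cmod (\<Sum>(js, ks)\<leftarrow>ps. foldr partial js f x * foldr partial ks g x)
      \<le> length ps * c n" if "\<forall>(js, ks)\<in>set ps. length js + length ks = n" for ps n
    using that
  proof (induction ps)
    case (Cons p ps)
    obtain js ks where p: "p = (js, ks)" by (cases p)
    have "cmod (foldr partial js f x * foldr partial ks g x) \<le> a (length js) * b (length ks)"
      unfolding norm_mult by (rule mult_mono'[OF a b]) auto
    also have "\<dots> \<le> c n" using c[of "length js" "length ks"] Cons.prems p by simp
    finally show ?case
      using Cons p norm_triangle_le[of "foldr partial js f x * foldr partial ks g x"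
          "\<Sum>(js, ks)\<leftarrow>ps. foldr partial js f x * foldr partial ks g x" "c n + length ps * c n"]
      by (simp add: algebra_simps)
  qed simp
  show ?thesis
    using *[of "leibniz_pairs is" "length is"] leibniz_pairs_length
    by (fastforce simp: foldr_partial_mult[OF assms(1,2)] length_leibniz_pairs)
qed

section \<open>Termwise differentiation of series\<close>

lemma partial_suminf:
  fixes f :: "nat \<Rightarrow> real ^ 'n::finite \<Rightarrow> complex"
  assumes f: "\<And>k. f k differentiable_on UNIV"
    and s: "\<And>x. summable (\<lambda>k. f k x)"
    and M: "\<And>R. \<exists>M. summable M \<and> (\<forall>i k x. norm x < R \<longrightarrow> cmod (partial i (f k) x) \<le> M k)"
  shows "((\<lambda>x. \<Sum>k. f k x) has_derivative (\<lambda>v. \<Sum>i\<in>UNIV. (v $ i) *\<^sub>R (\<Sum>k. partial i (f k) x))) (at x)"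
proof -
  \<comment> \<open>A convex open neighbourhood of \<open>x\<close> on which the derivative series
    converge uniformly by the M-test.\<close>
  define B where "B = ball (0 :: real ^ 'n) (norm x + 1)"
  have x: "x \<in> B" by (simp add: B_def)
  obtain M where M: "summable M" "\<And>i k y. y \<in> B \<Longrightarrow> cmod (partial i (f k) y) \<le> M k"
    using M[of "norm x + 1"] by (auto simp: B_def)
  let ?g' = "\<lambda>y v. \<Sum>i\<in>UNIV. (v $ i) *\<^sub>R (\<Sum>k. partial i (f k) y)"
  have "uniform_limit (UNIV \<times> B) (\<lambda>n (i, y). \<Sum>k<n. partial i (f k) y)
      (\<lambda>(i, y). \<Sum>k. partial i (f k) y) sequentially"
    using Weierstrass_m_test[of "UNIV \<times> B" "\<lambda>k (i, y). partial i (f k) y" M] M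
    by (auto simp: case_prod_unfold)
  note u = uniform_limitD[OF this]
  have "\<exists>g. \<forall>y\<in>B. (\<lambda>n. f n y) sums g y \<and> (g has_derivative ?g' y) (at y within B)"
  proof (rule has_derivative_series[where f' = "\<lambda>k y v. \<Sum>i\<in>UNIV. (v $ i) *\<^sub>R partial i (f k) y"])
    show "convex B" by (simp add: B_def)
    show "(f k has_derivative (\<lambda>v. \<Sum>i\<in>UNIV. (v $ i) *\<^sub>R partial i (f k) y)) (at y within B)" for k y
      by (rule has_derivative_at_withinI[OF has_derivative_partial])
        (use f in \<open>auto simp: differentiable_on_def\<close>)
    show "x \<in> B" by fact
    show "(\<lambda>n. f n x) sums (\<Sum>n. f n x)" using s by (rule summable_sums)
    fix e :: real assume "0 < e"
    \<comment> \<open>The error in the total derivative is a sum over the coordinates, each of which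
      receives an equal share of \<open>e\<close>.\<close>
    then have "0 < e / CARD('n)" by simp
    from u[OF this] show "\<forall>\<^sub>F n in sequentially. \<forall>y\<in>B. \<forall>v.
        cmod ((\<Sum>k<n. \<Sum>i\<in>UNIV. (v $ i) *\<^sub>R partial i (f k) y) - ?g' y v) \<le> e * norm v"
    proof eventually_elim
      case (elim n)
      show ?case
      proof (intro ballI allI)
        fix y v assume y: "y \<in> B"
        have "(\<Sum>k<n. \<Sum>i\<in>UNIV. (v $ i) *\<^sub>R partial i (f k) y) - ?g' y v =
            (\<Sum>i\<in>UNIV. (v $ i) *\<^sub>R ((\<Sum>k<n. partial i (f k) y) - (\<Sum>k. partial i (f k) y)))"
          by (subst sum.swap) (simp add: scaleR_sum_right sum_subtractf scaleR_diff_right)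
        also have "cmod \<dots> \<le> (\<Sum>i\<in>(UNIV :: 'n set). norm v * (e / CARD('n)))"
        proof (intro sum_norm_le)
          fix i :: 'n
          have "cmod ((\<Sum>k<n. partial i (f k) y) - (\<Sum>k. partial i (f k) y)) \<le> e / CARD('n)"
            using bspec[OF elim, of "(i, y)"] y by (simp add: dist_norm)
          then show "cmod ((v $ i) *\<^sub>R ((\<Sum>k<n. partial i (f k) y) - (\<Sum>k. partial i (f k) y)))
              \<le> norm v * (e / CARD('n))"
            unfolding norm_scaleR by (intro mult_mono component_le_norm_cart) auto
        qed
        also have "\<dots> = e * norm v" by simp
        finally show "cmod ((\<Sum>k<n. \<Sum>i\<in>UNIV. (v $ i) *\<^sub>R partial i (f k) y) - ?g' y v)
            \<le> e * norm v" .
      qed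
    qed
  qed
  then obtain g where g: "\<And>y. y \<in> B \<Longrightarrow> (\<lambda>n. f n y) sums g y"
    "(g has_derivative ?g' x) (at x within B)" using x by blast
  have "(\<Sum>n. f n y) = g y" if "y \<in> B" for y using g(1)[OF that] by (rule sums_unique[symmetric])
  then have "((\<lambda>y. \<Sum>n. f n y) has_derivative ?g' x) (at x within B)"
    using g(2) by (rule has_derivative_transform[OF x])
  then show ?thesis using at_within_open[OF x] by (simp add: B_def)
qed

lemma smooth_suminf:
  fixes h :: "nat \<Rightarrow> real ^ 'n::finite \<Rightarrow> complex"
  assumes h: "\<And>k. smooth (h k)"
    and M: "\<And>R is. \<exists>M. summable M \<and> (\<forall>k x. norm x < R \<longrightarrow> cmod (foldr partial is (h k) x) \<le> M k)"
  shows "smooth (\<lambda>x. \<Sum>k. h k x)"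
    and "foldr partial is (\<lambda>x. \<Sum>k. h k x) = (\<lambda>x. \<Sum>k. foldr partial is (h k) x)"
proof -
  have s: "summable (\<lambda>k. foldr partial is (h k) x)" for "is" x
  proof -
    obtain N where N: "summable N"
      "\<And>k y. norm y < norm x + 1 \<Longrightarrow> cmod (foldr partial is (h k) y) \<le> N k"
      using M[of "norm x + 1" "is"] by blast
    show ?thesis by (rule summable_comparison_test'[OF N(1), of 0]) (rule N(2), simp)
  qed
  have D: "((\<lambda>x. \<Sum>k. foldr partial is (h k) x) has_derivative
      (\<lambda>v. \<Sum>i\<in>UNIV. (v $ i) *\<^sub>R (\<Sum>k. partial i (foldr partial is (h k)) x))) (at x)" for "is" x
  proof (rule partial_suminf)
    fix R :: real
    \<comment> \<open>Enlarging the radius to at least 1 puts the origin into the ball; evaluating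
      there shows that the majorants are nonnegative.\<close>
    have "\<forall>i. \<exists>N. summable N \<and>
        (\<forall>k x. norm x < max R 1 \<longrightarrow> cmod (foldr partial (i # is) (h k) x) \<le> N k)"
      using M by blast
    then obtain N where N: "\<And>i. summable (N i)"
      "\<And>i k x. norm x < max R 1 \<Longrightarrow> cmod (foldr partial (i # is) (h k) x) \<le> N i k" by metis
    have N0: "0 \<le> N i k" for i k
      using order_trans[OF norm_ge_zero N(2)[of 0 i k]] by simp
    \<comment> \<open>The finite sum over the coordinates is one majorant valid for every direction
      \<open>i\<close>.\<close>
    have "cmod (partial i (foldr partial is (h k)) x) \<le> (\<Sum>j\<in>UNIV. \<bar>N j k\<bar>)"
      if "norm x < R" for i k x
    proof -
      have "cmod (partial i (foldr partial is (h k)) x) \<le> \<bar>N i k\<bar>"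
        using order_trans[OF N(2)[of x i k] abs_ge_self] that by simp
      also have "\<dots> \<le> (\<Sum>j\<in>UNIV. \<bar>N j k\<bar>)" by (rule member_le_sum) auto
      finally show ?thesis .
    qed
    moreover have "summable (\<lambda>k. \<Sum>j\<in>UNIV. \<bar>N j k\<bar>)"
      using N0 N(1) by (intro summable_sum) simp
    ultimately show "\<exists>M. summable M \<and>
        (\<forall>i k x. norm x < R \<longrightarrow> cmod (partial i (foldr partial is (h k)) x) \<le> M k)" by blast
  qed (use smooth_differentiable[OF h] s in auto)
  have eq: "foldr partial is (\<lambda>x. \<Sum>k. h k x) = (\<lambda>x. \<Sum>k. foldr partial is (h k) x)" for "is"
  proof (induction "is")
    case (Cons i "is")
    show ?case
      using partial_eqI[OF D, of i "is"] Cons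
      by (simp add: axis_def if_distrib[of "\<lambda>c. c *\<^sub>R _"] cong: if_cong)
  qed simp
  then show "foldr partial is (\<lambda>x. \<Sum>k. h k x) = (\<lambda>x. \<Sum>k. foldr partial is (h k) x)" .
  show "smooth (\<lambda>x. \<Sum>k. h k x)"
    unfolding smooth_def eq using D by (auto simp: differentiable_on_def differentiable_def)
qed

section \<open>Weight functions and the spaces \<open>\<O>\<^bsub>C,\<omega>\<^esub>\<close>\<close>

text \<open>The real number \<open>m \<phi>^*(j/m)\<close>, with \<open>m\<close> moved inside the
  supremum; \<open>young_conjugate_eq\<close> proves the identification.\<close>

definition weight_sup :: "(real \<Rightarrow> real) \<Rightarrow> nat \<Rightarrow> nat \<Rightarrow> real" where
  "weight_sup \<omega> m j = (SUP t\<in>{0..}. real j * t - real m * \<omega> (exp t))"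

locale weight =
  fixes \<omega> :: "real \<Rightarrow> real"
  assumes weight: "nonquasianalytic_weight \<omega>"
    and log_o: "(\<lambda>t. ln (1 + t)) \<in> o[at_top](\<omega>)"
begin

section \<open>Estimates for the Young conjugate\<close>

lemma \<omega>_nonneg: "0 \<le> t \<Longrightarrow> 0 \<le> \<omega> t"
  using weight by (simp add: nonquasianalytic_weight_def)

lemma \<omega>_mono: "0 \<le> s \<Longrightarrow> s \<le> t \<Longrightarrow> \<omega> s \<le> \<omega> t"
  using weight by (auto simp: nonquasianalytic_weight_def monotone_on_def)

lemma \<omega>_1: "\<omega> 1 = 0"
  using weight by (simp add: nonquasianalytic_weight_def)

lemma \<omega>_double: "\<exists>K\<ge>1. \<forall>t\<ge>0. \<omega> (2 * t) \<le> K * (1 + \<omega> t)"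
  using weight by (simp add: nonquasianalytic_weight_def)

text \<open>Since the logarithm is of smaller order than \<omega>, the penalty
  \<open>\<omega> (exp t)\<close> eventually exceeds any multiple of \<open>t\<close>. This makes
  the Young conjugate finite.\<close>

lemma weight_sup_bdd:
  assumes "1 \<le> m"
  shows "bdd_above ((\<lambda>t. real j * t - real m * \<omega> (exp t)) ` {0..})"
proof -
  \<comment> \<open>The small-o constant is the reciprocal of \<open>j + 1\<close>, a slope at least
    \<open>j\<close> that stays positive for \<open>j = 0\<close>.\<close>
  have "\<forall>\<^sub>F t in at_top. norm (ln (1 + t)) \<le> (1 / (real j + 1)) * norm (\<omega> t)"
    by (rule landau_o.smallD[OF log_o]) simp
  then obtain T where T: "\<And>t. t \<ge> T \<Longrightarrow> \<bar>ln (1 + t)\<bar> \<le> (1 / (real j + 1)) * \<bar>\<omega> t\<bar>"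
    unfolding eventually_at_top_linorder by auto
  have "real j * t - real m * \<omega> (exp t) \<le> real j * \<bar>T\<bar>" if t: "0 \<le> t" for t
  proof (cases "t \<le> \<bar>T\<bar>")
    case True
    then have "real j * t \<le> real j * \<bar>T\<bar>" by (intro mult_left_mono) auto
    moreover have "0 \<le> real m * \<omega> (exp t)" by (simp add: \<omega>_nonneg)
    ultimately show ?thesis by linarith
  next
    case False
    then have "T \<le> exp t" using exp_ge_add_one_self[of t] by linarith
    have "t \<le> ln (1 + exp t)" by (subst ln_ge_iff) (auto simp: add_pos_pos)
    also have "\<dots> \<le> (1 / (real j + 1)) * \<omega> (exp t)"
      using T[OF \<open>T \<le> exp t\<close>] by (simp add: \<omega>_nonneg)
    finally have "(real j + 1) * t \<le> \<omega> (exp t)" by (simp add: field_simps)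
    also have "\<dots> \<le> real m * \<omega> (exp t)"
      using assms mult_right_mono[of 1 "real m" "\<omega> (exp t)"] by (simp add: \<omega>_nonneg)
    finally have "real j * t \<le> real m * \<omega> (exp t)" using t by (simp add: algebra_simps)
    then show ?thesis using mult_nonneg_nonneg[OF of_nat_0_le_iff abs_ge_zero, of j T] by linarith
  qed
  then show ?thesis by (intro bdd_aboveI2) auto
qed

lemma weight_sup_upper:
  "1 \<le> m \<Longrightarrow> 0 \<le> t \<Longrightarrow> real j * t - real m * \<omega> (exp t) \<le> weight_sup \<omega> m j"
  unfolding weight_sup_def by (rule cSUP_upper[OF _ weight_sup_bdd]) auto

lemma weight_sup_least:
  "(\<And>t. 0 \<le> t \<Longrightarrow> real j * t - real m * \<omega> (exp t) \<le> c) \<Longrightarrow> weight_sup \<omega> m j \<le> c"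
  unfolding weight_sup_def by (rule cSUP_least) auto

lemma young_conjugate_eq:
  assumes "1 \<le> m"
  shows "ereal (real m) * young_conjugate \<omega> (real j / real m) = ereal (weight_sup \<omega> m j)"
proof -
  have "ereal (real m) * young_conjugate \<omega> (real j / real m) =
      (SUP t\<in>{0..}. ereal (real m) * ereal (real j / real m * t - \<omega> (exp t)))"
    unfolding young_conjugate_def
    by (rule Sup_ereal_mult_left') auto
  also have "\<dots> = (SUP t\<in>{0..}. ereal (real j * t - real m * \<omega> (exp t)))"
    using assms by (intro SUP_cong) (auto simp: algebra_simps)
  also have "\<dots> = ereal (weight_sup \<omega> m j)"
  proof (rule antisym)
    show "(SUP t\<in>{0..}. ereal (real j * t - real m * \<omega> (exp t))) \<le> ereal (weight_sup \<omega> m j)"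
      using weight_sup_upper[OF assms] by (intro SUP_least) auto
    have "weight_sup \<omega> m j \<le> c"
      if c: "(SUP t\<in>{0..}. ereal (real j * t - real m * \<omega> (exp t))) = ereal c" for c
    proof (rule weight_sup_least)
      fix t :: real assume "0 \<le> t"
      then have "ereal (real j * t - real m * \<omega> (exp t)) \<le> ereal c"
        unfolding c[symmetric] by (intro SUP_upper) auto
      then show "real j * t - real m * \<omega> (exp t) \<le> c" by simp
    qed
    \<comment> \<open>The value at \<open>t = 0\<close> is 0 because \<omega> vanishes at 1; this
      excludes minus infinity in the case distinction below.\<close>
    moreover have "ereal 0 \<le> (SUP t\<in>{0..}. ereal (real j * t - real m * \<omega> (exp t)))"
      by (rule SUP_upper2[of 0]) (auto simp: \<omega>_1)
    ultimately show "ereal (weight_sup \<omega> m j) \<le> (SUP t\<in>{0..}. ereal (real j * t - real m * \<omega> (exp t)))"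
      by (cases "SUP t\<in>{0..}. ereal (real j * t - real m * \<omega> (exp t))") auto
  qed
  finally show ?thesis .
qed

text \<open>For two competitors \<open>s\<close>, \<open>t\<close> take their maximum: the linear
  parts do not decrease, and its single penalty is one of the two given penalties, the other being
  nonnegative. This makes products of growth bounds depend on the total order of
  differentiation.\<close>

lemma weight_sup_add:
  assumes "1 \<le> m"
  shows "weight_sup \<omega> m i + weight_sup \<omega> m j \<le> weight_sup \<omega> m (i + j)"
proof -
  have *: "(real i * s - real m * \<omega> (exp s)) + (real j * t - real m * \<omega> (exp t)) \<le> weight_sup \<omega> m (i + j)"
    if "0 \<le> s" "0 \<le> t" for s t
  proof -
    let ?u = "max s t"
    have "real i * s \<le> real i * ?u" "real j * t \<le> real j * ?u" by (auto intro: mult_left_mono)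
    moreover have "real m * \<omega> (exp ?u) \<le> real m * \<omega> (exp s) + real m * \<omega> (exp t)"
      using \<omega>_nonneg[of "exp s"] \<omega>_nonneg[of "exp t"] by (simp add: max_def)
    moreover have "real (i + j) * ?u - real m * \<omega> (exp ?u) \<le> weight_sup \<omega> m (i + j)"
      using that by (intro weight_sup_upper[OF assms]) auto
    ultimately show ?thesis by (simp add: algebra_simps)
  qed
  have "weight_sup \<omega> m i \<le> weight_sup \<omega> m (i + j) - weight_sup \<omega> m j"
  proof (rule weight_sup_least)
    fix s :: real assume s: "0 \<le> s"
    have "weight_sup \<omega> m j \<le> weight_sup \<omega> m (i + j) - (real i * s - real m * \<omega> (exp s))"
      by (rule weight_sup_least) (use *[OF s] in \<open>force simp: algebra_simps\<close>)
    then show "real i * s - real m * \<omega> (exp s) \<le> weight_sup \<omega> m (i + j) - weight_sup \<omega> m j"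
      by simp
  qed
  then show ?thesis by simp
qed

lemma weight_sup_antimono:
  assumes "1 \<le> m" "m \<le> m'"
  shows "weight_sup \<omega> m' j \<le> weight_sup \<omega> m j"
proof (rule weight_sup_least)
  fix t :: real assume t: "0 \<le> t"
  have "real m * \<omega> (exp t) \<le> real m' * \<omega> (exp t)"
    using assms(2) by (intro mult_right_mono) (auto simp: \<omega>_nonneg)
  then show "real j * t - real m' * \<omega> (exp t) \<le> weight_sup \<omega> m j"
    using weight_sup_upper[OF assms(1) t, of j] by linarith
qed

text \<open>Substituting \<open>t + ln 2\<close> for \<open>t\<close> turns the factor \<open>2 ^ j\<close> into a dilation, which
  condition \<open>(\<alpha>)\<close> absorbs.\<close>

lemma weight_sup_dilate:
  assumes "1 \<le> m"
  obtains m' where "m \<le> m'" "\<And>j. real j * ln 2 + weight_sup \<omega> m' j \<le> weight_sup \<omega> m j + real m'"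
proof -
  obtain K where K: "K \<ge> 1" "\<And>t. t \<ge> 0 \<Longrightarrow> \<omega> (2 * t) \<le> K * (1 + \<omega> t)" using \<omega>_double by blast
  \<comment> \<open>Condition \<open>(\<alpha>)\<close> multiplies the weight by \<open>K\<close>,
    so \<open>m'\<close> must be at least \<open>K * m\<close>. The constant 1 in
    \<open>K * (1 + \<omega> t)\<close> accounts for the additive \<open>real m'\<close> in the
    conclusion.\<close>
  define m' where "m' = nat \<lceil>K * real m\<rceil>"
  have m': "K * real m \<le> real m'" unfolding m'_def by linarith
  have "1 * real m \<le> K * real m" using K(1) by (intro mult_right_mono) auto
  with m' have "m \<le> m'" by simp
  moreover have "real j * ln 2 + weight_sup \<omega> m' j \<le> weight_sup \<omega> m j + real m'" for j
  proof -
    have "weight_sup \<omega> m' j \<le> weight_sup \<omega> m j + real m' - real j * ln 2"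
    proof (rule weight_sup_least)
      fix t :: real assume t: "0 \<le> t"
      have "real m * \<omega> (exp (t + ln 2)) \<le> real m * (K * (1 + \<omega> (exp t)))"
        using K(2)[of "exp t"] by (intro mult_left_mono) (auto simp: exp_add mult.commute)
      also have "\<dots> = (K * real m) * (1 + \<omega> (exp t))" by simp
      also have "\<dots> \<le> real m' * (1 + \<omega> (exp t))"
        by (intro mult_right_mono m') (simp add: \<omega>_nonneg)
      finally have "real m * \<omega> (exp (t + ln 2)) \<le> real m' * (1 + \<omega> (exp t))" .
      moreover have "real j * (t + ln 2) - real m * \<omega> (exp (t + ln 2)) \<le> weight_sup \<omega> m j"
        using t by (intro weight_sup_upper[OF assms]) auto
      ultimately show "real j * t - real m' * \<omega> (exp t) \<le> weight_sup \<omega> m j + real m' - real j * ln 2"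
        by (simp add: algebra_simps)
    qed
    then show ?thesis by simp
  qed
  ultimately show thesis by (rule that)
qed

text \<open>The reciprocal of the exponential factor in \<open>r_norm\<close>, so that a norm bound
  becomes a pointwise real inequality.\<close>

definition growth :: "nat \<Rightarrow> nat \<Rightarrow> nat \<Rightarrow> real ^ 'n::finite \<Rightarrow> real" where
  "growth m n j x = exp (real n * \<omega> (norm x) + weight_sup \<omega> m j)"

definition real_r_norm :: "nat \<Rightarrow> nat \<Rightarrow> (real ^ 'n::finite \<Rightarrow> complex) \<Rightarrow> real" where
  "real_r_norm m n f = real_of_ereal (r_norm \<omega> m n f)"

lemma growth_pos: "0 < growth m n j x"
  by (simp add: growth_def)

lemma r_norm_le_iff:
  assumes "1 \<le> m"
  shows "r_norm \<omega> m n f \<le> ereal c \<longleftrightarrow> (\<forall>\<alpha> x. cmod (mderiv \<alpha> f x) \<le> c * growth m n (mabs \<alpha>) x)"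
proof -
  have "ereal (cmod (mderiv \<alpha> f x)) * exp_ereal (- ereal (real n * \<omega> (norm x)) -
      ereal (real m) * young_conjugate \<omega> (real (mabs \<alpha>) / real m))
    = ereal (cmod (mderiv \<alpha> f x) / growth m n (mabs \<alpha>) x)" for \<alpha> x
    by (simp add: young_conjugate_eq[OF assms] growth_def exp_diff exp_minus exp_add divide_simps)
  then show ?thesis
    by (simp add: r_norm_def SUP_le_iff pos_divide_le_eq[OF growth_pos])
qed

lemma r_norm_nonneg:
  fixes f :: "real ^ 'n::finite \<Rightarrow> complex"
  assumes m: "1 \<le> m"
  shows "0 \<le> r_norm \<omega> m n f"
proof (rule ccontr)
  assume "\<not> 0 \<le> r_norm \<omega> m n f"
  then obtain c where c: "c < 0" "r_norm \<omega> m n f \<le> ereal c"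
    by (metis ereal_dense2 less_ereal.simps(1) linorder_not_le order_less_imp_le zero_ereal_def)
  have "cmod (mderiv (\<lambda>i. 0) f 0) \<le> c * growth m n (mabs (\<lambda>i :: 'n. 0)) (0 :: real ^ 'n)"
    using c(2) unfolding r_norm_le_iff[OF m] by blast
  also have "\<dots> < 0" using c(1) growth_pos by (rule mult_neg_pos)
  finally show False by simp
qed

text \<open>Together with \<open>O_mn_I\<close> this is the interface to \<open>r_norm\<close>: a
  norm bound is the same as a growth bound for the derivatives along all coordinate lists.\<close>

lemma O_mn_bound:
  assumes m: "1 \<le> m" and f: "f \<in> O_mn \<omega> m n"
  shows "cmod (foldr partial is f x) \<le> real_r_norm m n f * growth m n (length is) x" "0 \<le> real_r_norm m n f" "smooth f"
proof -
  show sm: "smooth f" using f by (simp add: O_mn_def)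
  have "\<bar>r_norm \<omega> m n f\<bar> \<noteq> \<infinity>" using f r_norm_nonneg[OF m, of n f] by (auto simp: O_mn_def)
  then have "r_norm \<omega> m n f \<le> ereal (real_r_norm m n f)" by (simp add: real_r_norm_def ereal_real)
  then have "\<forall>\<alpha> x. cmod (mderiv \<alpha> f x) \<le> real_r_norm m n f * growth m n (mabs \<alpha>) x"
    by (simp add: r_norm_le_iff[OF m])
  then show "cmod (foldr partial is f x) \<le> real_r_norm m n f * growth m n (length is) x"
    using foldr_partial_eq_mderiv[OF sm, of "is"] by metis
  show "0 \<le> real_r_norm m n f" unfolding real_r_norm_def by (rule real_of_ereal_pos[OF r_norm_nonneg[OF m]])
qed

lemma O_mn_I:
  assumes m: "1 \<le> m" and f: "smooth f"
    and le: "\<And>is x. cmod (foldr partial is f x) \<le> c * growth m n (length is) x"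
  shows "f \<in> O_mn \<omega> m n" "real_r_norm m n f \<le> c"
proof -
  have le: "r_norm \<omega> m n f \<le> ereal c"
    unfolding r_norm_le_iff[OF m] mderiv_eq_foldr using le length_multiindex_list by metis
  then show "f \<in> O_mn \<omega> m n" using f by (auto simp: O_mn_def)
  show "real_r_norm m n f \<le> c"
    using le r_norm_nonneg[OF m, of n f] unfolding real_r_norm_def
    by (cases "r_norm \<omega> m n f") auto
qed

lemma growth_mono: "n \<le> n' \<Longrightarrow> growth m n j x \<le> growth m n' j x"
  by (simp add: growth_def mult_right_mono \<omega>_nonneg)

lemma growth_antimono: "1 \<le> m \<Longrightarrow> m \<le> m' \<Longrightarrow> growth m' n j x \<le> growth m n j x"
  by (simp add: growth_def weight_sup_antimono)

lemma growth_mult: "1 \<le> m \<Longrightarrow> growth m n i x * growth m l j x \<le> growth m (n + l) (i + j) x"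
  using weight_sup_add[of m i j] by (simp add: growth_def algebra_simps flip: exp_add)

lemma growth_dilate:
  assumes "1 \<le> m"
  obtains m' where "m \<le> m'"
    "\<And>n j (x :: real ^ 'n::finite). 2 ^ j * growth m' n j x \<le> exp (real m') * growth m n j x"
proof -
  obtain m' where m': "m \<le> m'"
    "\<And>j. real j * ln 2 + weight_sup \<omega> m' j \<le> weight_sup \<omega> m j + real m'"
    using weight_sup_dilate[OF assms] by metis
  have "2 ^ j * growth m' n j x \<le> exp (real m') * growth m n j x" for n j and x :: "real ^ 'n"
  proof -
    have "(2::real) ^ j = exp (real j * ln 2)" by (simp add: exp_of_nat_mult)
    then show ?thesis using m'(2)[of j] by (simp add: growth_def flip: exp_add)
  qed
  with m'(1) show thesis by (rule that)
qed

section \<open>Algebraic operations, inclusions and completeness\<close>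

lemma O_mn_add:
  assumes m: "1 \<le> m" and f: "f \<in> O_mn \<omega> m n" and g: "g \<in> O_mn \<omega> m n"
  shows "(\<lambda>x. f x + g x) \<in> O_mn \<omega> m n" "real_r_norm m n (\<lambda>x. f x + g x) \<le> real_r_norm m n f + real_r_norm m n g"
proof -
  note f' = O_mn_bound[OF m f] and g' = O_mn_bound[OF m g]
  have le: "cmod (foldr partial is (\<lambda>x. f x + g x) x) \<le> (real_r_norm m n f + real_r_norm m n g) * growth m n (length is) x"
    for "is" x
    using norm_triangle_le[OF add_mono[OF f'(1)[of "is" x] g'(1)[of "is" x]]]
    by (simp add: foldr_partial_add[OF f'(3) g'(3)] algebra_simps)
  show "(\<lambda>x. f x + g x) \<in> O_mn \<omega> m n" "real_r_norm m n (\<lambda>x. f x + g x) \<le> real_r_norm m n f + real_r_norm m n g"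
    by (rule O_mn_I[OF m smooth_add[OF f'(3) g'(3)] le])+
qed

lemma O_mn_0:
  assumes m: "1 \<le> m"
  shows "(\<lambda>x :: real ^ 'n::finite. 0) \<in> O_mn \<omega> m n" "real_r_norm m n (\<lambda>x :: real ^ 'n. 0) = 0"
proof -
  show 0: "(\<lambda>x :: real ^ 'n. 0) \<in> O_mn \<omega> m n"
    by (rule O_mn_I(1)[OF m smooth_0, of 0]) (simp add: foldr_partial_0)
  have "real_r_norm m n (\<lambda>x :: real ^ 'n. 0) \<le> 0"
    by (rule O_mn_I(2)[OF m smooth_0]) (simp add: foldr_partial_0)
  then show "real_r_norm m n (\<lambda>x :: real ^ 'n. 0) = 0" using O_mn_bound(2)[OF m 0] by linarith
qed

lemma O_mn_cmult_le:
  assumes m: "1 \<le> m" and f: "f \<in> O_mn \<omega> m n"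
  shows "(\<lambda>x. c * f x) \<in> O_mn \<omega> m n" "real_r_norm m n (\<lambda>x. c * f x) \<le> cmod c * real_r_norm m n f"
proof -
  note f' = O_mn_bound[OF m f]
  have le: "cmod (foldr partial is (\<lambda>x. c * f x) x) \<le> (cmod c * real_r_norm m n f) * growth m n (length is) x"
    for "is" x
    using mult_left_mono[OF f'(1)[of "is" x] norm_ge_zero[of c]]
    by (simp add: foldr_partial_cmult[OF f'(3)] norm_mult mult_ac)
  show "(\<lambda>x. c * f x) \<in> O_mn \<omega> m n" "real_r_norm m n (\<lambda>x. c * f x) \<le> cmod c * real_r_norm m n f"
    by (rule O_mn_I[OF m smooth_cmult[OF f'(3)] le])+
qed

lemma O_mn_cmult:
  assumes m: "1 \<le> m" and f: "f \<in> O_mn \<omega> m n"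
  shows "real_r_norm m n (\<lambda>x. c * f x) = cmod c * real_r_norm m n f"
proof (cases "c = 0")
  case False
  have "real_r_norm m n f \<le> cmod (1 / c) * real_r_norm m n (\<lambda>x. c * f x)"
    using O_mn_cmult_le(2)[OF m O_mn_cmult_le(1)[OF m f], of "1 / c" c] False by simp
  then have "cmod c * real_r_norm m n f \<le> real_r_norm m n (\<lambda>x. c * f x)"
    using False by (simp add: norm_divide field_simps)
  with O_mn_cmult_le(2)[OF m f, of c] show ?thesis by linarith
qed (simp add: O_mn_0[OF m])

text \<open>Both factors are measured at level \<open>m'\<close>; superadditivity combines their
  growth there, and the drop from \<open>m'\<close> to \<open>m\<close> pays for the number of
  Leibniz terms. The choice of \<open>m'\<close> depends on \<open>m\<close> only and serves all
  \<open>n\<close> and \<open>l\<close>.\<close>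

lemma O_mn_mult:
  assumes m: "1 \<le> m"
  obtains m' where "m \<le> m'"
    "\<And>n l (f :: real ^ 'n::finite \<Rightarrow> complex) g. f \<in> O_mn \<omega> m' n \<Longrightarrow> g \<in> O_mn \<omega> m' l \<Longrightarrow>
      (\<lambda>x. f x * g x) \<in> O_mn \<omega> m (n + l) \<and>
      real_r_norm m (n + l) (\<lambda>x. f x * g x) \<le> exp (real m') * real_r_norm m' n f * real_r_norm m' l g"
proof -
  obtain m' where m': "m \<le> m'"
    "\<And>n j (x :: real ^ 'n). 2 ^ j * growth m' n j x \<le> exp (real m') * growth m n j x"
    using growth_dilate[OF m, where ?'n = 'n] by metis
  have m1: "1 \<le> m'" using m m' by simp
  show thesis
  proof (rule that[OF m'(1)])
    fix n l and f g :: "real ^ 'n \<Rightarrow> complex"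
    assume f: "f \<in> O_mn \<omega> m' n" and g: "g \<in> O_mn \<omega> m' l"
    note f' = O_mn_bound[OF m1 f] and g' = O_mn_bound[OF m1 g]
    let ?c = "real_r_norm m' n f * real_r_norm m' l g"
    have c: "0 \<le> ?c" using f'(2) g'(2) by simp
    have le: "cmod (foldr partial is (\<lambda>x. f x * g x) x)
        \<le> (exp (real m') * ?c) * growth m (n + l) (length is) x" for "is" x
    proof -
      have "(real_r_norm m' n f * growth m' n i x) * (real_r_norm m' l g * growth m' l j x) \<le> ?c * growth m' (n + l) (i + j) x" for i j
        using mult_left_mono[OF growth_mult[OF m1, of n i x l j] c] by (simp add: mult_ac)
      from norm_foldr_partial_mult_le[OF f'(3) g'(3) f'(1) g'(1) this]
      have "cmod (foldr partial is (\<lambda>x. f x * g x) x)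
          \<le> 2 ^ length is * (?c * growth m' (n + l) (length is) x)" .
      also have "\<dots> = ?c * (2 ^ length is * growth m' (n + l) (length is) x)" by simp
      also have "\<dots> \<le> ?c * (exp (real m') * growth m (n + l) (length is) x)"
        by (rule mult_left_mono[OF m'(2) c])
      finally show ?thesis by (simp add: mult_ac)
    qed
    show "(\<lambda>x. f x * g x) \<in> O_mn \<omega> m (n + l) \<and>
        real_r_norm m (n + l) (\<lambda>x. f x * g x) \<le> exp (real m') * real_r_norm m' n f * real_r_norm m' l g"
      using O_mn_I[OF m smooth_mult[OF f'(3) g'(3)] le] by (simp add: mult.assoc)
  qed
qed

lemma O_mn_mono:
  assumes m: "1 \<le> m" and n: "n \<le> n'"
  shows "O_mn \<omega> m n \<subseteq> O_mn \<omega> m n'"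
proof
  fix f assume f: "f \<in> O_mn \<omega> m n"
  note f' = O_mn_bound[OF m f]
  show "f \<in> O_mn \<omega> m n'"
    by (rule O_mn_I(1)[OF m f'(3) order_trans[OF f'(1) mult_left_mono[OF growth_mono[OF n] f'(2)]]])
qed

lemma real_r_norm_mono:
  assumes m: "1 \<le> m" "m \<le> m'" and f: "f \<in> O_mn \<omega> m' n"
  shows "real_r_norm m n f \<le> real_r_norm m' n f"
proof -
  have "1 \<le> m'" using m by simp
  note f' = O_mn_bound[OF this f]
  show ?thesis
    by (rule O_mn_I(2)[OF m(1) f'(3) order_trans[OF f'(1) mult_left_mono[OF growth_antimono[OF m] f'(2)]]])
qed

text \<open>In the norm with index \<open>m\<close>, all terms from \<open>k = m - 1\<close> on are
  dominated by the geometric series, because the norms increase with \<open>m\<close>. Every tail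
  that starts late enough is therefore small together with all its derivatives.\<close>

lemma O_mn_complete:
  fixes h :: "nat \<Rightarrow> real ^ 'n::finite \<Rightarrow> complex"
  assumes h: "\<And>m k. 1 \<le> m \<Longrightarrow> h k \<in> O_mn \<omega> m n" and le: "\<And>k. real_r_norm (Suc k) n (h k) \<le> (1/2) ^ k"
  shows "\<And>m. 1 \<le> m \<Longrightarrow> (\<lambda>x. \<Sum>k. h k x) \<in> O_mn \<omega> m n"
    and "\<And>m. 1 \<le> m \<Longrightarrow> (\<lambda>N. real_r_norm m n (\<lambda>x. (\<Sum>k. h k x) - (\<Sum>k<N. h k x))) \<longlonglongrightarrow> 0"
proof -
  have sm: "smooth (h k)" for k using O_mn_bound(3)[OF _ h] by blast
  have bound: "cmod (foldr partial is (h k) x) \<le> (1/2) ^ k * growth m n (length is) x"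
    if "1 \<le> m" "m \<le> Suc k" for k m "is" x
  proof -
    have "h k \<in> O_mn \<omega> (Suc k) n" by (rule h) simp
    from real_r_norm_mono[OF that this] have "real_r_norm m n (h k) \<le> (1/2) ^ k" using le[of k] by linarith
    then show ?thesis
      using O_mn_bound(1)[OF that(1) h[OF that(1)], of "is" k x] mult_right_mono growth_pos
      by (meson order_trans less_imp_le)
  qed
  \<comment> \<open>The norm with index 1 controls every term, since \<open>1 \<le> Suc k\<close>;
    on the ball, \<omega> is at most its value at \<open>R\<close>.\<close>
  have dom: "\<exists>M. summable M \<and> (\<forall>k x. norm x < R \<longrightarrow> cmod (foldr partial is (h k) x) \<le> M k)" for R "is"
  proof (intro exI conjI allI impI)
    show "summable (\<lambda>k. (1/2) ^ k * exp (real n * \<omega> R + weight_sup \<omega> 1 (length is)))"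
      by (intro summable_mult2 summable_geometric) simp
    fix k and x :: "real ^ 'n" assume "norm x < R"
    then have "growth 1 n (length is) x \<le> exp (real n * \<omega> R + weight_sup \<omega> 1 (length is))"
      by (simp add: growth_def mult_left_mono \<omega>_mono)
    then show "cmod (foldr partial is (h k) x)
        \<le> (1/2) ^ k * exp (real n * \<omega> R + weight_sup \<omega> 1 (length is))"
      using bound[of 1 k "is" x] mult_left_mono[of _ _ "(1/2 :: real) ^ k"]
      by (fastforce intro: order_trans)
  qed
  note S = smooth_suminf[OF sm dom]
  \<comment> \<open>The condition \<open>m \<le> N\<close> ensures that every term of the tail is
    covered by \<open>bound\<close>; the factor 2 is the sum of the geometric series.\<close>
  have tail_O: "(\<lambda>x. (\<Sum>k. h k x) - (\<Sum>k<N. h k x)) \<in> O_mn \<omega> m n \<and>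
      real_r_norm m n (\<lambda>x. (\<Sum>k. h k x) - (\<Sum>k<N. h k x)) \<le> 2 * (1/2) ^ N"
    if m: "1 \<le> m" and N: "m \<le> N" for m N
  proof -
    have psum: "smooth (\<lambda>x. \<Sum>k<N. h k x) \<and>
        foldr partial is (\<lambda>x. \<Sum>k<N. h k x) = (\<lambda>x. \<Sum>k<N. foldr partial is (h k) x)" for N "is"
      by (induction N) (auto simp: smooth_0 foldr_partial_0 smooth_add foldr_partial_add sm)
    have "cmod (foldr partial is (\<lambda>x. (\<Sum>k. h k x) - (\<Sum>k<N. h k x)) x)
        \<le> (2 * (1/2) ^ N) * growth m n (length is) x" for "is" x
    proof -
      let ?a = "\<lambda>k. foldr partial is (h k) x" and ?w = "growth m n (length is) x"
      have b: "cmod (?a (k + N)) \<le> ((1/2) ^ N * ?w) * (1/2) ^ k" for k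
        using bound[OF m, of "k + N" "is" x] N by (simp add: power_add mult_ac)
      have geo: "(\<lambda>k. ((1/2) ^ N * ?w) * (1/2) ^ k) sums (((1/2) ^ N * ?w) * 2)"
        using sums_mult[OF geometric_sums[of "1/2 :: real"], of "(1/2) ^ N * ?w"] by simp
      have abs: "summable (\<lambda>k. cmod (?a (k + N)))"
        by (rule summable_comparison_test'[OF sums_summable[OF geo], of 0]) (simp add: b)
      have "summable (\<lambda>k. ?a k)"
        using summable_norm_cancel[OF abs] by (rule summable_iff_shift[THEN iffD1])
      then have "foldr partial is (\<lambda>x. (\<Sum>k. h k x) - (\<Sum>k<N. h k x)) x = (\<Sum>k. ?a (k + N))"
        using suminf_minus_initial_segment[of ?a N]
        by (simp add: foldr_partial_diff[OF S(1) conjunct1[OF psum]] S(2) psum)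
      also have "cmod \<dots> \<le> (\<Sum>k. cmod (?a (k + N)))" by (rule summable_norm[OF abs])
      also have "\<dots> \<le> (\<Sum>k. ((1/2) ^ N * ?w) * (1/2) ^ k)"
        by (rule suminf_le[OF b abs sums_summable[OF geo]])
      also have "\<dots> = (2 * (1/2) ^ N) * ?w" using sums_unique[OF geo] by simp
      finally show ?thesis .
    qed
    from O_mn_I[OF m smooth_diff[OF S(1) conjunct1[OF psum]] this] show ?thesis by blast
  qed
  show "(\<lambda>x. \<Sum>k. h k x) \<in> O_mn \<omega> m n" if m: "1 \<le> m" for m
  proof -
    have "(\<lambda>x. \<Sum>k<N. h k x) \<in> O_mn \<omega> m n" for N
    proof (induction N)
      case (Suc N)
      from O_mn_add(1)[OF m this h[OF m]] show ?case by simp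
    qed (use O_mn_0(1)[OF m] in simp)
    \<comment> \<open>The sum is the tail from \<open>N = m\<close> plus the first \<open>m\<close>
      terms, which belong to the space individually.\<close>
    from O_mn_add(1)[OF m conjunct1[OF tail_O[OF m order_refl]] this[of m]] show ?thesis by simp
  qed
  show "(\<lambda>N. real_r_norm m n (\<lambda>x. (\<Sum>k. h k x) - (\<Sum>k<N. h k x))) \<longlonglongrightarrow> 0" if m: "1 \<le> m" for m
  proof (rule tendsto_sandwich)
    show "\<forall>\<^sub>F N in sequentially. 0 \<le> real_r_norm m n (\<lambda>x. (\<Sum>k. h k x) - (\<Sum>k<N. h k x))"
      using tail_O[OF m] O_mn_bound(2)[OF m] by (auto simp: eventually_sequentially)
    show "\<forall>\<^sub>F N in sequentially. real_r_norm m n (\<lambda>x. (\<Sum>k. h k x) - (\<Sum>k<N. h k x)) \<le> 2 * (1/2) ^ N"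
      using tail_O[OF m] by (auto simp: eventually_sequentially)
    show "(\<lambda>N. 2 * (1/2) ^ N :: real) \<longlonglongrightarrow> 0"
      by (intro tendsto_mult_right_zero LIMSEQ_power_zero) simp
  qed auto
qed

text \<open>The abstract norms are numbered from 0 but \<open>r_norm\<close> from
  \<open>m = 1\<close>, hence the shift \<open>Suc k\<close>.\<close>

sublocale lf_algebra "\<lambda>n. \<Inter>m\<in>{1..}. O_mn \<omega> m n :: (real ^ 'n::finite \<Rightarrow> complex) set"
  "\<lambda>n k. real_r_norm (Suc k) n"
proof unfold_locales
  fix n :: nat
  let ?E = "\<lambda>n. \<Inter>m\<in>{1..}. O_mn \<omega> m n :: (real ^ 'n \<Rightarrow> complex) set"
  have I: "f \<in> O_mn \<omega> (Suc k) n" if "f \<in> ?E n" for f k n using that by auto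
  show "linear_space (?E n)"
    unfolding linear_space_def by (auto intro: O_mn_0 O_mn_add O_mn_cmult_le)
  show "?E n \<subseteq> ?E n'" if "n \<le> n'" for n' using O_mn_mono[OF _ that] by blast
  show "seminorm_on (?E n) (real_r_norm (Suc k) n)" for k
    unfolding seminorm_on_def
    using O_mn_bound(2)[OF _ I] O_mn_add(2)[OF _ I I] O_mn_cmult[OF _ I] by simp
  show "real_r_norm (Suc k) n f \<le> real_r_norm (Suc l) n f" if "f \<in> ?E n" "k \<le> l" for f k l
    using that by (intro real_r_norm_mono I) auto
  show "\<exists>f\<in>?E n. \<forall>m. (\<lambda>N. real_r_norm (Suc m) n (\<lambda>x. f x - (\<Sum>k<N. h k x))) \<longlonglongrightarrow> 0"
    if h: "\<And>k. h k \<in> ?E n" "\<And>k. real_r_norm (Suc k) n (h k) \<le> (1/2) ^ k" for h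
  proof -
    have "h k \<in> O_mn \<omega> m n" if "1 \<le> m" for m k using h(1)[of k] that by auto
    note * = O_mn_complete[OF this h(2)]
    show ?thesis
    proof (intro bexI allI)
      show "(\<lambda>x. \<Sum>k. h k x) \<in> ?E n" using *(1) by blast
      show "(\<lambda>N. real_r_norm (Suc m) n (\<lambda>x. (\<Sum>k. h k x) - (\<Sum>k<N. h k x))) \<longlonglongrightarrow> 0" for m
        by (rule *(2)) simp_all
    qed
  qed
  fix l :: nat
  show "(\<lambda>x. f x * g x) \<in> ?E (n + l)" if f: "f \<in> ?E n" and g: "g \<in> ?E l" for f g
  proof
    fix m :: nat assume "m \<in> {1..}"
    then have m: "1 \<le> m" by simp
    then obtain m' where "m \<le> m'" "\<And>n l (f :: real ^ 'n \<Rightarrow> complex) g. f \<in> O_mn \<omega> m' n \<Longrightarrow>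
        g \<in> O_mn \<omega> m' l \<Longrightarrow> (\<lambda>x. f x * g x) \<in> O_mn \<omega> m (n + l)"
      using O_mn_mult[OF m, where ?'n = 'n] by metis
    with m f g show "(\<lambda>x. f x * g x) \<in> O_mn \<omega> m (n + l)" by auto
  qed
  show "\<exists>m' C. \<forall>f\<in>?E n. \<forall>g\<in>?E l.
      real_r_norm (Suc m) (n + l) (\<lambda>x. f x * g x) \<le> C * real_r_norm (Suc m') n f * real_r_norm (Suc m') l g" for m
  proof -
    obtain m' where m': "Suc m \<le> m'" "\<And>n l (f :: real ^ 'n \<Rightarrow> complex) g. f \<in> O_mn \<omega> m' n \<Longrightarrow>
        g \<in> O_mn \<omega> m' l \<Longrightarrow> real_r_norm (Suc m) (n + l) (\<lambda>x. f x * g x) \<le> exp (real m') * real_r_norm m' n f * real_r_norm m' l g"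
      by (rule O_mn_mult[of "Suc m", where ?'n = 'n]) auto
    then obtain k where k: "m' = Suc k" by (cases m') auto
    show ?thesis
    proof (intro exI ballI)
      fix f g assume "f \<in> ?E n" "g \<in> ?E l"
      from m'(2)[unfolded k, OF I[OF this(1)] I[OF this(2)]]
      show "real_r_norm (Suc m) (n + l) (\<lambda>x. f x * g x)
          \<le> exp (real (Suc k)) * real_r_norm (Suc k) n f * real_r_norm (Suc k) l g" .
    qed
  qed
qed

lemma limit_top_eq_O_C: "limit_top = O_C \<omega>"
proof -
  have eq: "{\<lambda>f. real_of_ereal (r_norm \<omega> m n f) |m. m \<ge> 1} = range (\<lambda>k. real_r_norm (Suc k) n)" for n
    unfolding real_r_norm_def
    by (auto simp: image_iff) (metis One_nat_def Suc_le_D)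
  show ?thesis by (simp only: limit_top_def O_C_def O_step_def[abs_def] eq)
qed

lemma mult_eq_mult_functional: "mult = mult_functional \<omega>"
  unfolding fun_eq_iff mult_def mult_functional_def limit_top_eq_O_C[symmetric] topspace_limit_top by simp

end

theorem proposition4p6:
  fixes \<omega> :: "real \<Rightarrow> real"
  assumes "nonquasianalytic_weight \<omega>"
    and "(\<lambda>t. ln (1 + t)) \<in> o[at_top](\<omega>)"
  shows "bilinear_map (topspace (O_C \<omega> :: (real ^ 'n::finite \<Rightarrow> complex) topology))
           (topspace (O_C_dual \<omega>)) (topspace (O_C_dual \<omega>)) (mult_functional \<omega>) \<and>
         separately_continuous (O_C \<omega> :: (real ^ 'n \<Rightarrow> complex) topology)
           (O_C_dual \<omega>) (O_C_dual \<omega>) (mult_functional \<omega>) \<and>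
         hypocontinuous (O_C \<omega> :: (real ^ 'n \<Rightarrow> complex) topology)
           (O_C_dual \<omega>) (O_C_dual \<omega>) (mult_functional \<omega>)"
proof -
  interpret weight \<omega> using assms by unfold_locales
  show ?thesis
    using hypocontinuous_mult unfolding O_C_dual_def limit_top_eq_O_C mult_eq_mult_functional by blast
qed

end
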